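(* Let $\rho^k\nearrow\infty$ and let $(u^k,v^k,\tilde v^k)_k$ be a sequence generated by the Penalty-$\varepsilon$-ADM method (defined in the context) with penalty parameters $\rho^k$, such that $(u^k,v^k,\tilde v^k)\to(u^*,v^*,\tilde v^* )$ in $U_t\times V_t\times V_t$, and let $(u^*,v^*,\tilde v^* )$ be feasible for the split problem $$\min_{u,v,\tilde v}\ \Psi(u,v)\quad\text{s.t.}\quad u\in\Sigma\subset U_t,\ v=\tilde v,\ \tilde v\in\Gamma\subset V_t,\ v\in V_t .$$ Then $(u^*,v^* )$ is p-minimal for the reduced problem $$\min_{u,v}\ \Psi(u,v)\quad\text{s.t.}\quad u\in\Sigma\subset U_t,\ v\in\Gamma\subset V_t .$$
   Context: Setting: $T>0$, $M\in\mathbb{N}$, $p\in(0,\infty]$; $Y$ and $U$ are Banach spaces; $U_t=L^p(0,T;U)$, $V_t=L^\infty(0,T;\{0,1\}^M)$; $\Sigma\subset U_t$ and $\Gamma\subset V_t$ are given sets; $y_0\in Y$; $A$ is a densely defined linear operator on $Y$; $f\colon Y\times U\times\{0,1\}^M\to Y$; $|w|_{l_1}=\sum_{i=1}^M|w_i|$. Standing assumption: $A$ generates a strongly continuous semigroup $(e^{tA})_{t\ge0}$ on $Y$, and there is $K>0$ such that for all $v\in\{0,1\}^M$: (i) $(y,u)\mapsto f(y,u,v)$ is continuous on $Y\times U$; (ii) $\|f(y,u,v)\|_Y\le K(1+\|y\|_Y)$ for all $y\in Y$, $u\in U$; (iii) $\|f(y,u,v)-f(z,u,v)\|_Y\le K\|y-z\|_Y$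 for all $y,z\in Y$, $u\in U$. Moreover $\Phi\colon Y\to\mathbb{R}$ is Lipschitz continuous on bounded subsets of $Y$. For $u\in U_t$, $v\in V_t$, $y(\cdot;u,v)\in C([0,T];Y)$ is the unique mild solution of $\dot y=Ay+f(y,u,v)$, $y(0)=y_0$, i.e. $y(t)=e^{tA}y_0+\int_0^te^{(t-\tau)A}f(y(\tau),u(\tau),v(\tau))\,d\tau$, and $\Psi(u,v):=\Phi(y(T;u,v))$. p-minimality: a point $([u^*,v^*],\tilde v^* )$ is p-$\varepsilon$-optimal for the split problem (with respect to the blocks $(u,v)$ and $\tilde v$) if its objective value is at most $\varepsilon$ plus the objective value of every feasible point having the same $\tilde v$-component $\tilde v^*$, and also at most $\varepsilon$ plus the objective value of every feasible point having the same $(u,v)$-component $(u^*,v^* )$. A point $(u^*,v^* )$ is p-$\varepsilon$-minimal for the reduced problem if $([u^*,v^*],v^* )$ is p-$\varepsilon$-optimal for the split problem; p-minimal means p-$\varepsilon$-minimal with $\varepsilon=0$. Penalty problem with parameter $\rho\ge0$: minimize $\Psi_\rho(u,v,\tilde v):=\Psi(u,v)+\rho\int_0^T|v(t)-\tilde v(t)|_{l_1}\,dt$ over $u\in\Sigma$, $v\in V_t$, $\tilde v\in\Gamma$. An $\frac{\varepsilon}{2}$-optimal solution of a minimization problem is a feasible point whose objective value is at most the objective value of every feasible point plus $\frac{\varepsilon}{2}$. Penalty-$\varepsilon$-ADM method, for a given $\varepsilon\ge0$: choose $(u^{(0,* )},v^{(0,* )},\tilde v^{(0,* )})\in\Sigma\times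 V_t\times\Gamma$ and $\rho^{1}=0$. For $k=1,2,3,\dots$: set $(u^{(k,0)},v^{(k,0)},\tilde v^{(k,0)})=(u^{(k-1,* )},v^{(k-1,* )},\tilde v^{(k-1,* )})$ and, for $l=0,1,2,\dots$, do the following. (1) For $\tilde v^{(k,l)}$ fixed, find an $\frac{\varepsilon}{2}$-optimal solution $(u^{(k,l+1)},v^{(k,l+1)})\in\Sigma\times V_t$ of the penalty problem with parameter $\rho^k$. (2) If $\Psi_{\rho^k}(u^{(k,l+1)},v^{(k,l+1)},\tilde v^{(k,l)})\ge\Psi_{\rho^k}(u^{(k,l)},v^{(k,l)},\tilde v^{(k,l)})-\frac{\varepsilon}{2}$, set $(u^{(k,* )},v^{(k,* )},\tilde v^{(k,* )})=(u^{(k,l)},v^{(k,l)},\tilde v^{(k,l)})$ and leave the inner loop. (3) For $(u^{(k,l+1)},v^{(k,l+1)})$ fixed, find an $\frac{\varepsilon}{2}$-optimal solution $\tilde v^{(k,l+1)}\in\Gamma$ of the penalty problem with parameter $\rho^k$. (4) If $\Psi_{\rho^k}(u^{(k,l+1)},v^{(k,l+1)},\tilde v^{(k,l+1)})\ge\Psi_{\rho^k}(u^{(k,l+1)},v^{(k,l+1)},\tilde v^{(k,l)})-\frac{\varepsilon}{2}$, set $(u^{(k,* )},v^{(k,* )},\tilde v^{(k,* )})=(u^{(k,l+1)},v^{(k,l+1)},\tilde v^{(k,l)})$ and leave the inner loop. After the inner loop, choose $\rho^{k+1}>\rho^k$. A sequence generated by the method is the sequence of outer iterates $(u^k,v^k,\tilde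 v^k):=(u^{(k,* )},v^{(k,* )},\tilde v^{(k,* )})$, where the inner loop terminates for every $k$.
   Formalization: For a method run with ε > 0 the limit need not be p-minimal (an ε/2-optimal start can be kept forever), so the formal theorem concludes that (u*,v* ) is p-ε-minimal with the ε of the method, and p-minimal when ε = 0. *)

theory Defs
  imports "HOL-Analysis.Analysis" "HOL-Probability.Essential_Supremum"
begin

subsection \<open>Function spaces on \<open>(0,T)\<close>\<close>

abbreviation leb :: "real \<Rightarrow> real measure" where
  "leb T \<equiv> lebesgue_on {0<..<T}"

text \<open>Bochner measurability. The values lie in a Banach space that need not be separable, where
  plain Borel measurability would be too weak.\<close>

definition strongly_measurable :: "'a measure \<Rightarrow> ('a \<Rightarrow> 'b::real_normed_vector) \<Rightarrow> bool" where
  "strongly_measurable M g \<longleftrightarrow>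
     (\<exists>s. (\<forall>n. simple_function M (s n)) \<and> (AE x in M. (\<lambda>n. s n x) \<longlonglongrightarrow> g x))"

text \<open>An element of \<open>L\<^sup>p(0,T;B)\<close> is represented by any function in its class modulo equality almost
  everywhere on \<open>(0,T)\<close>. Accordingly, a subset of \<open>L\<^sup>p(0,T;B)\<close> is a set of functions that contains
  with each function all functions almost everywhere equal to it (\<open>ae_closed\<close>).\<close>

definition Lp :: "real \<Rightarrow> ennreal \<Rightarrow> (real \<Rightarrow> 'b::real_normed_vector) set" where
  "Lp T p = {g. strongly_measurable (leb T) g \<and>
     (if p = \<infinity> then esssup (leb T) (\<lambda>t. ennreal (norm (g t))) < \<infinity>
      else integrable (leb T) (\<lambda>t. norm (g t) powr enn2real p))}"

definition Lp_norm :: "real \<Rightarrow> ennreal \<Rightarrow> (real \<Rightarrow> 'b::real_normed_vector) \<Rightarrow> real" where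
  "Lp_norm T p g =
     (if p = \<infinity> then enn2real (esssup (leb T) (\<lambda>t. ennreal (norm (g t))))
      else (LINT t|leb T. norm (g t) powr enn2real p) powr (1 / enn2real p))"

text \<open>For \<open>p < 1\<close> the function \<open>Lp_norm\<close> is only a quasi-norm; the convergence is the usual one.\<close>

definition Lp_tendsto ::
  "real \<Rightarrow> ennreal \<Rightarrow> (nat \<Rightarrow> real \<Rightarrow> 'b::real_normed_vector) \<Rightarrow> (real \<Rightarrow> 'b) \<Rightarrow> bool" where
  "Lp_tendsto T p g h \<longleftrightarrow> (\<lambda>k. Lp_norm T p (\<lambda>t. g k t - h t)) \<longlonglongrightarrow> 0"

definition ae_closed :: "real \<Rightarrow> (real \<Rightarrow> 'b) set \<Rightarrow> bool" where
  "ae_closed T X \<longleftrightarrow> (\<forall>g\<in>X. \<forall>h. (AE t in leb T. h t = g t) \<longrightarrow> h \<in> X)"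

definition binary :: "(real^'m) set" where
  "binary = {w. \<forall>i. w $ i \<in> {0, 1}}"

definition l1_norm :: "real^'m \<Rightarrow> real" where
  "l1_norm w = (\<Sum>i\<in>UNIV. \<bar>w $ i\<bar>)"

definition Vt :: "real \<Rightarrow> (real \<Rightarrow> real^'m) set" where
  "Vt T = {v \<in> Lp T \<infinity>. AE t in leb T. v t \<in> binary}"

subsection \<open>The evolution equation\<close>

definition densely_defined_linear :: "'y::real_normed_vector set \<Rightarrow> ('y \<Rightarrow> 'y) \<Rightarrow> bool" where
  "densely_defined_linear D A \<longleftrightarrow>
     subspace D \<and> closure D = UNIV \<and>
     (\<forall>x\<in>D. \<forall>y\<in>D. A (x + y) = A x + A y) \<and> (\<forall>c. \<forall>x\<in>D. A (c *\<^sub>R x) = c *\<^sub>R A x)"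

text \<open>Only the values \<open>S t\<close> for \<open>t \<ge> 0\<close> are relevant.\<close>

definition C0_semigroup :: "(real \<Rightarrow> 'y::real_normed_vector \<Rightarrow>\<^sub>L 'y) \<Rightarrow> bool" where
  "C0_semigroup S \<longleftrightarrow>
     S 0 = id_blinfun \<and>
     (\<forall>s\<ge>0. \<forall>t\<ge>0. S (s + t) = S s o\<^sub>L S t) \<and>
     (\<forall>x. ((\<lambda>t. S t x) \<longlongrightarrow> x) (at_right 0))"

definition generates :: "'y set \<Rightarrow> ('y \<Rightarrow> 'y) \<Rightarrow> (real \<Rightarrow> 'y::real_normed_vector \<Rightarrow>\<^sub>L 'y) \<Rightarrow> bool" where
  "generates D A S \<longleftrightarrow>
     C0_semigroup S \<and>
     D = {x. \<exists>l. ((\<lambda>h. (S h x - x) /\<^sub>R h) \<longlongrightarrow> l) (at_right 0)} \<and>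
     (\<forall>x\<in>D. ((\<lambda>h. (S h x - x) /\<^sub>R h) \<longlongrightarrow> A x) (at_right 0))"

text \<open>The library's Bochner integral is restricted to separable spaces, so the integral in the mild
  solution formula is the gauge integral of Banach-valued functions. Whenever \<open>y\<close> is continuous and
  the right-hand side \<open>f\<close> has linear growth and is Lipschitz in \<open>y\<close> as assumed below, the integrand
  is strongly measurable and bounded, and the gauge and Bochner integrals coincide.\<close>

definition mild_solution ::
  "real \<Rightarrow> (real \<Rightarrow> 'y::banach \<Rightarrow>\<^sub>L 'y) \<Rightarrow> ('y \<Rightarrow> 'u \<Rightarrow> real^'m \<Rightarrow> 'y) \<Rightarrow> 'y \<Rightarrow>
   (real \<Rightarrow> 'u) \<Rightarrow> (real \<Rightarrow> real^'m) \<Rightarrow> (real \<Rightarrow> 'y) \<Rightarrow> bool" where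
  "mild_solution T S f y0 u v y \<longleftrightarrow>
     continuous_on {0..T} y \<and>
     (\<forall>t\<in>{0..T}. ((\<lambda>\<tau>. S (t - \<tau>) (f (y \<tau>) (u \<tau>) (v \<tau>))) has_integral (y t - S t y0)) {0..t})"

text \<open>The mild solution exists and is unique on \<open>{0..T}\<close> under the standing assumptions; it is
  unspecified outside that interval, hence the use of \<open>SOME\<close>.\<close>

definition state ::
  "real \<Rightarrow> (real \<Rightarrow> 'y::banach \<Rightarrow>\<^sub>L 'y) \<Rightarrow> ('y \<Rightarrow> 'u \<Rightarrow> real^'m \<Rightarrow> 'y) \<Rightarrow> 'y \<Rightarrow>
   (real \<Rightarrow> 'u) \<Rightarrow> (real \<Rightarrow> real^'m) \<Rightarrow> real \<Rightarrow> 'y" where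
  "state T S f y0 u v = (SOME y. mild_solution T S f y0 u v y)"

definition reduced_cost ::
  "real \<Rightarrow> (real \<Rightarrow> 'y::banach \<Rightarrow>\<^sub>L 'y) \<Rightarrow> ('y \<Rightarrow> 'u \<Rightarrow> real^'m \<Rightarrow> 'y) \<Rightarrow> 'y \<Rightarrow> ('y \<Rightarrow> real) \<Rightarrow>
   (real \<Rightarrow> 'u) \<Rightarrow> (real \<Rightarrow> real^'m) \<Rightarrow> real" where
  "reduced_cost T S f y0 \<Phi> u v = \<Phi> (state T S f y0 u v T)"

definition admissible_rhs :: "('y::real_normed_vector \<Rightarrow> 'u::real_normed_vector \<Rightarrow> real^'m \<Rightarrow> 'y) \<Rightarrow> bool" where
  "admissible_rhs f \<longleftrightarrow>
     (\<exists>K>0. \<forall>v\<in>binary.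
        continuous_on UNIV (\<lambda>(y, u). f y u v) \<and>
        (\<forall>y u. norm (f y u v) \<le> K * (1 + norm y)) \<and>
        (\<forall>y z u. norm (f y u v - f z u v) \<le> K * norm (y - z)))"

definition lipschitz_on_bounded :: "('y::real_normed_vector \<Rightarrow> real) \<Rightarrow> bool" where
  "lipschitz_on_bounded \<Phi> \<longleftrightarrow> (\<forall>B. bounded B \<longrightarrow> (\<exists>L. L-lipschitz_on B \<Phi>))"

subsection \<open>Approximate optimality and partial minimality\<close>

definition eps_optimal :: "real \<Rightarrow> 'a set \<Rightarrow> ('a \<Rightarrow> real) \<Rightarrow> 'a \<Rightarrow> bool" where
  "eps_optimal \<delta> F J x \<longleftrightarrow> x \<in> F \<and> (\<forall>x'\<in>F. J x \<le> J x' + \<delta>)"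

text \<open>In \<open>p_eps_optimal\<close> and \<open>p_eps_minimal\<close> the letter p stands for ``partially'' and is unrelated
  to the exponent of \<open>L\<^sup>p\<close>; the two blocks are the components of a pair.\<close>

definition p_eps_optimal :: "real \<Rightarrow> ('a \<times> 'b) set \<Rightarrow> ('a \<times> 'b \<Rightarrow> real) \<Rightarrow> 'a \<times> 'b \<Rightarrow> bool" where
  "p_eps_optimal \<epsilon> F J z \<longleftrightarrow>
     z \<in> F \<and>
     (\<forall>z'\<in>F. snd z' = snd z \<longrightarrow> J z \<le> J z' + \<epsilon>) \<and>
     (\<forall>z'\<in>F. fst z' = fst z \<longrightarrow> J z \<le> J z' + \<epsilon>)"

definition split_feasible ::
  "real \<Rightarrow> (real \<Rightarrow> 'u) set \<Rightarrow> (real \<Rightarrow> real^'m) set \<Rightarrow>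
   (((real \<Rightarrow> 'u) \<times> (real \<Rightarrow> real^'m)) \<times> (real \<Rightarrow> real^'m)) set" where
  "split_feasible T \<Sigma> \<Gamma> =
     {((u, v), w). u \<in> \<Sigma> \<and> v \<in> Vt T \<and> w \<in> \<Gamma> \<and> (AE t in leb T. v t = w t)}"

definition p_eps_minimal ::
  "real \<Rightarrow> ((real \<Rightarrow> 'u) \<Rightarrow> (real \<Rightarrow> real^'m) \<Rightarrow> real) \<Rightarrow> (real \<Rightarrow> 'u) set \<Rightarrow>
   (real \<Rightarrow> real^'m) set \<Rightarrow> real \<Rightarrow> (real \<Rightarrow> 'u) \<Rightarrow> (real \<Rightarrow> real^'m) \<Rightarrow> bool" where
  "p_eps_minimal T \<Psi> \<Sigma> \<Gamma> \<epsilon> u v \<longleftrightarrow>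
     p_eps_optimal \<epsilon> (split_feasible T \<Sigma> \<Gamma>) (\<lambda>((u, v), w). \<Psi> u v) ((u, v), v)"

definition p_minimal ::
  "real \<Rightarrow> ((real \<Rightarrow> 'u) \<Rightarrow> (real \<Rightarrow> real^'m) \<Rightarrow> real) \<Rightarrow> (real \<Rightarrow> 'u) set \<Rightarrow>
   (real \<Rightarrow> real^'m) set \<Rightarrow> (real \<Rightarrow> 'u) \<Rightarrow> (real \<Rightarrow> real^'m) \<Rightarrow> bool" where
  "p_minimal T \<Psi> \<Sigma> \<Gamma> u v \<longleftrightarrow> p_eps_minimal T \<Psi> \<Sigma> \<Gamma> 0 u v"

subsection \<open>The penalty alternating direction method\<close>

definition penalty_cost ::
  "real \<Rightarrow> ((real \<Rightarrow> 'u) \<Rightarrow> (real \<Rightarrow> real^'m) \<Rightarrow> real) \<Rightarrow> real \<Rightarrow>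
   (real \<Rightarrow> 'u) \<times> (real \<Rightarrow> real^'m) \<Rightarrow> (real \<Rightarrow> real^'m) \<Rightarrow> real" where
  "penalty_cost T \<Psi> \<rho> = (\<lambda>(u, v) w. \<Psi> u v + \<rho> * (LINT t|leb T. l1_norm (v t - w t)))"

text \<open>\<open>adm_inner \<epsilon> J F G (x, w) r\<close>: the inner loop with block-wise objective \<open>J\<close> over \<open>x \<in> F\<close> and
  \<open>w \<in> G\<close>, entered at \<open>(x, w)\<close>, can terminate with result \<open>r\<close>. The choice of the approximate
  minimizers is nondeterministic.\<close>

inductive adm_inner ::
  "real \<Rightarrow> ('a \<Rightarrow> 'b \<Rightarrow> real) \<Rightarrow> 'a set \<Rightarrow> 'b set \<Rightarrow> 'a \<times> 'b \<Rightarrow> 'a \<times> 'b \<Rightarrow> bool"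
  for \<epsilon> J F G where
  stop_fst:
    "eps_optimal (\<epsilon> / 2) F (\<lambda>x. J x w) x' \<Longrightarrow>
     J x' w \<ge> J x w - \<epsilon> / 2 \<Longrightarrow>
     adm_inner \<epsilon> J F G (x, w) (x, w)"
| stop_snd:
    "eps_optimal (\<epsilon> / 2) F (\<lambda>x. J x w) x' \<Longrightarrow>
     J x' w < J x w - \<epsilon> / 2 \<Longrightarrow>
     eps_optimal (\<epsilon> / 2) G (J x') w' \<Longrightarrow>
     J x' w' \<ge> J x' w - \<epsilon> / 2 \<Longrightarrow>
     adm_inner \<epsilon> J F G (x, w) (x', w)"
| continue:
    "eps_optimal (\<epsilon> / 2) F (\<lambda>x. J x w) x' \<Longrightarrow>
     J x' w < J x w - \<epsilon> / 2 \<Longrightarrow>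
     eps_optimal (\<epsilon> / 2) G (J x') w' \<Longrightarrow>
     J x' w' < J x' w - \<epsilon> / 2 \<Longrightarrow>
     adm_inner \<epsilon> J F G (x', w') r \<Longrightarrow>
     adm_inner \<epsilon> J F G (x, w) r"

text \<open>\<open>X k\<close> is the \<open>k\<close>-th outer iterate and \<open>\<rho> k\<close> the penalty parameter of outer iteration
  \<open>k \<ge> 1\<close>; the value \<open>\<rho> 0\<close> is not used.\<close>

definition penalty_adm ::
  "real \<Rightarrow> ((real \<Rightarrow> 'u) \<Rightarrow> (real \<Rightarrow> real^'m) \<Rightarrow> real) \<Rightarrow> (real \<Rightarrow> 'u) set \<Rightarrow>
   (real \<Rightarrow> real^'m) set \<Rightarrow> real \<Rightarrow> (nat \<Rightarrow> real) \<Rightarrow>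
   (nat \<Rightarrow> ((real \<Rightarrow> 'u) \<times> (real \<Rightarrow> real^'m)) \<times> (real \<Rightarrow> real^'m)) \<Rightarrow> bool" where
  "penalty_adm T \<Psi> \<Sigma> \<Gamma> \<epsilon> \<rho> X \<longleftrightarrow>
     X 0 \<in> (\<Sigma> \<times> Vt T) \<times> \<Gamma> \<and> \<rho> 1 = 0 \<and>
     (\<forall>k\<ge>1. adm_inner \<epsilon> (penalty_cost T \<Psi> (\<rho> k)) (\<Sigma> \<times> Vt T) \<Gamma> (X (k - 1)) (X k) \<and>
            \<rho> k < \<rho> (k + 1))"

end

theory Submission
  imports Defs
begin

text \<open>
  Two facts carry the proof. First, functions with values in \<open>{0,1}\<^sup>M\<close> have distance less than
  \<open>1\<close> in \<open>L\<^sup>\<infinity>\<close> only if they coincide almost everywhere. Since \<open>v\<^sub>k\<close> and \<open>w\<^sub>k\<close> converge in \<open>L\<^sup>\<infinity>\<close> to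
  \<open>vs = ws\<close>, they eventually equal this limit almost everywhere
  (\<open>Vt_Linf_tendsto_eventually_AE_eq\<close>). However large the penalty parameter is, the penalty term
  then vanishes both at the iterate and at every competitor \<open>(u', v')\<close> with \<open>v' = vs\<close>. The outer
  iterates are \<open>\<epsilon>\<close>-optimal in the block \<open>(u, v)\<close> for the penalty problem, whichever stopping test
  ended the inner loop (\<open>adm_inner_fst_optimal\<close>), so \<open>\<Psi>(u\<^sub>k, v\<^sub>k) \<le> \<Psi>(u', v') + \<epsilon>\<close> for all large \<open>k\<close>.

  Second, \<open>\<Psi>(u\<^sub>k, v\<^sub>k) \<longlonglongrightarrow> \<Psi>(us, vs)\<close> along a subsequence (\<open>reduced_cost_tendsto_subseq\<close>), and the limit
  of the inequality is the condition on the block \<open>(u, v)\<close>. The condition on the other block holds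
  with equality because the objective of the split problem depends on \<open>(u, v)\<close> only.

  The continuity of \<open>\<Psi>\<close> is where the evolution equation enters. A subsequence of \<open>u\<^sub>k\<close> converges
  almost everywhere. Along it the right-hand sides evaluated at the limit state converge almost
  everywhere and boundedly, hence in \<open>L\<^sup>1\<close>, and Gronwall's lemma turns this into convergence of the
  states at time \<open>T\<close> (\<open>mild_stability\<close>, \<open>state_tendsto\<close>). As \<open>state\<close> is an arbitrary choice among the
  mild solutions, this argument needs that mild solutions exist. They are fixed points of a
  contraction in an exponentially weighted supremum norm (\<open>mild_fixpoint_exists\<close>). The stability
  estimate compares any two mild solutions, so it covers whichever one is chosen.

  The state equation integrates functions with values in a possibly nonseparable Banach space by the gauge
  integral. The link to measure theory is that a bounded strongly measurable function is gauge
  integrable (\<open>strongly_measurable_integrable_on\<close>), because its Riemann sums are controlled by those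
  of an integrable approximation and of the real-valued error (\<open>has_integral_L1_limit\<close>).
\<close>

section \<open>Strong measurability\<close>

lemma strongly_measurable_Pair:
  assumes "strongly_measurable M a" and "strongly_measurable M b"
  shows "strongly_measurable M (\<lambda>t. (a t, b t))"
proof -
  obtain sa sb where sa: "\<And>n. simple_function M (sa n)" "AE x in M. (\<lambda>n. sa n x) \<longlonglongrightarrow> a x"
    and sb: "\<And>n. simple_function M (sb n)" "AE x in M. (\<lambda>n. sb n x) \<longlonglongrightarrow> b x"
    using assms unfolding strongly_measurable_def by blast
  have "AE x in M. (\<lambda>n. (sa n x, sb n x)) \<longlonglongrightarrow> (a x, b x)"
    using sa(2) sb(2) by eventually_elim (rule tendsto_Pair)
  then show ?thesis
    unfolding strongly_measurable_def using sa(1) sb(1)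
    by (intro exI[of _ "\<lambda>n x. (sa n x, sb n x)"]) simp
qed

text \<open>
  Continuity is required only at the values of \<open>a\<close>, and only almost everywhere. This admits maps
  \<open>h\<close> with jumps, such as rounding to \<open>{0,1}\<close>, or a semigroup cut off at negative times.
\<close>

lemma strongly_measurable_isCont:
  assumes "strongly_measurable M a" and "AE t in M. isCont h (a t)"
  shows "strongly_measurable M (\<lambda>t. h (a t))"
proof -
  obtain s where s: "\<And>n. simple_function M (s n)" "AE x in M. (\<lambda>n. s n x) \<longlonglongrightarrow> a x"
    using assms unfolding strongly_measurable_def by blast
  have "AE x in M. (\<lambda>n. h (s n x)) \<longlonglongrightarrow> h (a x)"
    using s(2) assms(2) by eventually_elim (rule isCont_tendsto_compose)
  then show ?thesis
    unfolding strongly_measurable_def using simple_function_compose1[OF s(1)]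
    by (intro exI[of _ "\<lambda>n x. h (s n x)"]) blast
qed

lemma borel_measurable_imp_strongly_measurable:
  fixes g :: "'a \<Rightarrow> 'b::{real_normed_vector, second_countable_topology}"
  assumes "g \<in> borel_measurable M"
  shows "strongly_measurable M g"
proof -
  obtain s where "\<And>n. simple_function M (s n)" "\<And>x. x \<in> space M \<Longrightarrow> (\<lambda>n. s n x) \<longlonglongrightarrow> g x"
    using borel_measurable_implies_sequence_metric[OF assms] by metis
  then show ?thesis unfolding strongly_measurable_def by (intro exI[of _ s]) auto
qed

lemma strongly_measurable_continuous:
  fixes y :: "real \<Rightarrow> 'b::real_normed_vector"
  assumes "continuous_on UNIV y"
  shows "strongly_measurable lebesgue y"
proof -
  have "strongly_measurable lebesgue (\<lambda>t::real. t)"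
    by (intro borel_measurable_imp_strongly_measurable measurable_completion) simp
  then show ?thesis
    by (rule strongly_measurable_isCont) (use assms in \<open>auto simp: continuous_on_eq_continuous_at\<close>)
qed

lemma strongly_measurable_extend:
  assumes "strongly_measurable (lebesgue_on S) g" and S: "S \<in> sets lebesgue"
  shows "strongly_measurable lebesgue (\<lambda>t. if t \<in> S then g t else 0)"
proof -
  obtain s where s: "\<And>n. simple_function (lebesgue_on S) (s n)"
    "AE x in lebesgue_on S. (\<lambda>n. s n x) \<longlonglongrightarrow> g x"
    using assms unfolding strongly_measurable_def by blast
  define s' where "s' n x = (if x \<in> S then s n x else 0)" for n x
  have "simple_function lebesgue (s' n)" for n
  proof -
    have fin: "finite (s n ` S)" and fib: "\<And>y. y \<in> s n ` S \<Longrightarrow> s n -` {y} \<inter> S \<in> sets lebesgue"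
      using s(1)[of n] S by (auto simp: simple_function_def sets_restrict_space_iff)
    have "range (s' n) \<subseteq> insert 0 (s n ` S)" by (auto simp: s'_def)
    then have "finite (range (s' n))" using fin by (meson finite.insertI finite_subset)
    moreover have "s' n -` {y} \<in> sets lebesgue" for y
    proof -
      have "s' n -` {y} = (s n -` {y} \<inter> S) \<union> (if y = 0 then - S else {})"
        by (auto simp: s'_def split: if_splits)
      moreover have "s n -` {y} \<inter> S \<in> sets lebesgue"
      proof (cases "y \<in> s n ` S")
        case False
        then have "s n -` {y} \<inter> S = {}" by auto
        then show ?thesis by simp
      qed (rule fib)
      moreover have "- S \<in> sets lebesgue" using S by (simp add: Compl_in_sets_lebesgue)
      ultimately show ?thesis by auto
    qed
    ultimately show ?thesis by (simp add: simple_function_def)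
  qed
  moreover have "AE x in lebesgue. (\<lambda>n. s' n x) \<longlonglongrightarrow> (if x \<in> S then g x else 0)"
    using s(2) S by (simp add: AE_restrict_space_iff) (auto elim!: eventually_mono simp: s'_def)
  ultimately show ?thesis unfolding strongly_measurable_def by blast
qed

text \<open>
  The limit of the norms of the simple functions is measurable, and changing it on a null set
  keeps it so because the Lebesgue measure is complete.
\<close>

lemma strongly_measurable_norm:
  assumes "strongly_measurable lebesgue (g :: real \<Rightarrow> 'b::real_normed_vector)"
  shows "(\<lambda>t. norm (g t)) \<in> borel_measurable lebesgue"
proof -
  obtain s where s: "\<And>n. simple_function lebesgue (s n)" "AE x in lebesgue. (\<lambda>n. s n x) \<longlonglongrightarrow> g x"
    using assms unfolding strongly_measurable_def by blast
  have "(\<lambda>x. norm (s n x)) \<in> borel_measurable lebesgue" for n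
    by (rule borel_measurable_simple_function) (rule simple_function_compose1[OF s(1)])
  then have m: "(\<lambda>x. lim (\<lambda>n. norm (s n x))) \<in> borel_measurable lebesgue"
    by (rule borel_measurable_lim_metric)
  have "AE x in lebesgue. lim (\<lambda>n. norm (s n x)) = norm (g x)"
    using s(2) by eventually_elim (intro limI tendsto_norm)
  then show ?thesis by (rule borel_measurable_AE[OF m])
qed

section \<open>The gauge integral of bounded strongly measurable functions\<close>

text \<open>
  The error bound \<open>\<phi> n\<close> is itself gauge integrable, so on a common fine division the Riemann sums
  of \<open>g\<close> and \<open>s n\<close> differ by at most the Riemann sum of \<open>\<phi> n\<close>, which is close to \<open>r n\<close>. This takes
  the place of dominated convergence for functions whose values lie in an arbitrary Banach space.
\<close>

lemma has_integral_L1_limit: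
  fixes g :: "'n::euclidean_space \<Rightarrow> 'a::banach"
  assumes s: "\<And>n. (s n has_integral J n) (cbox a b)"
    and \<phi>: "\<And>n. (\<phi> n has_integral r n) (cbox a b)"
    and le: "\<And>n x. x \<in> cbox a b \<Longrightarrow> norm (s n x - g x) \<le> \<phi> n x"
    and r: "r \<longlonglongrightarrow> 0"
  shows "g integrable_on cbox a b"
proof -
  have JJ: "norm (J n - J m) \<le> r n + r m" for n m
  proof -
    have "((\<lambda>x. s n x - s m x) has_integral (J n - J m)) (cbox a b)"
      by (intro has_integral_diff s)
    moreover have "((\<lambda>x. \<phi> n x + \<phi> m x) has_integral (r n + r m)) (cbox a b)"
      by (intro has_integral_add \<phi>)
    moreover have "norm (s n x - s m x) \<le> \<phi> n x + \<phi> m x" if "x \<in> cbox a b" for x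
      using le[OF that, of n] le[OF that, of m] norm_triangle_ineq4[of "s n x - g x" "s m x - g x"]
      by simp
    ultimately show ?thesis
      using integral_norm_bound_integral[of "\<lambda>x. s n x - s m x" "cbox a b" "\<lambda>x. \<phi> n x + \<phi> m x"]
      by (auto simp: has_integral_iff)
  qed
  have "Cauchy J"
  proof (rule CauchyI)
    fix e :: real assume "e > 0"
    then obtain N where N: "\<And>n. n \<ge> N \<Longrightarrow> norm (r n) < e / 2"
      using LIMSEQ_D[OF r, of "e/2"] by auto
    show "\<exists>M. \<forall>m\<ge>M. \<forall>n\<ge>M. norm (J m - J n) < e"
    proof (intro exI[of _ N] allI impI)
      fix m n assume "m \<ge> N" "n \<ge> N"
      then show "norm (J m - J n) < e" using N[of m] N[of n] JJ[of m n] by auto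
    qed
  qed
  then obtain I where I: "J \<longlonglongrightarrow> I" using Cauchy_convergent_iff convergent_def by blast
  have "(g has_integral I) (cbox a b)"
    unfolding has_integral
  proof (intro allI impI)
    fix e :: real assume e: "e > 0"
    obtain n where n: "norm (r n) < e / 4" "norm (J n - I) < e / 4"
    proof -
      have "\<forall>\<^sub>F n in sequentially. dist (r n) 0 < e / 4" using r e by (intro tendstoD) auto
      moreover have "\<forall>\<^sub>F n in sequentially. dist (J n) I < e / 4" using I e by (intro tendstoD) auto
      ultimately have "\<forall>\<^sub>F n in sequentially. dist (r n) 0 < e / 4 \<and> dist (J n) I < e / 4"
        by eventually_elim auto
      then show thesis using that by (auto simp: eventually_sequentially dist_norm)
    qed
    obtain \<gamma>1 where \<gamma>1: "gauge \<gamma>1" and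
      R1: "\<And>D. D tagged_division_of cbox a b \<Longrightarrow> \<gamma>1 fine D \<Longrightarrow>
        norm ((\<Sum>(x, k)\<in>D. measure lborel k *\<^sub>R s n x) - J n) < e / 4"
      using s[of n, unfolded has_integral, rule_format, of "e/4"] e by auto
    obtain \<gamma>2 where \<gamma>2: "gauge \<gamma>2" and
      R2: "\<And>D. D tagged_division_of cbox a b \<Longrightarrow> \<gamma>2 fine D \<Longrightarrow>
        norm ((\<Sum>(x, k)\<in>D. measure lborel k *\<^sub>R \<phi> n x) - r n) < e / 4"
      using \<phi>[of n, unfolded has_integral, rule_format, of "e/4"] e by auto
    show "\<exists>\<gamma>. gauge \<gamma> \<and> (\<forall>D. D tagged_division_of cbox a b \<and> \<gamma> fine D \<longrightarrow>
        norm ((\<Sum>(x, k)\<in>D. measure lborel k *\<^sub>R g x) - I) < e)"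
    proof (intro exI[of _ "\<lambda>x. \<gamma>1 x \<inter> \<gamma>2 x"] conjI allI impI)
      show "gauge (\<lambda>x. \<gamma>1 x \<inter> \<gamma>2 x)" using \<gamma>1 \<gamma>2 by (rule gauge_Int)
      fix D assume "D tagged_division_of cbox a b \<and> (\<lambda>x. \<gamma>1 x \<inter> \<gamma>2 x) fine D"
      then have D: "D tagged_division_of cbox a b" and f: "\<gamma>1 fine D" "\<gamma>2 fine D"
        by (auto simp: fine_Int)
      have "norm ((\<Sum>(x, k)\<in>D. measure lborel k *\<^sub>R s n x) - (\<Sum>(x, k)\<in>D. measure lborel k *\<^sub>R g x))
          = norm (\<Sum>(x, k)\<in>D. measure lborel k *\<^sub>R (s n x - g x))"
        by (simp add: sum_subtractf split_def algebra_simps)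
      also have "\<dots> \<le> (\<Sum>(x, k)\<in>D. measure lborel k *\<^sub>R \<phi> n x)"
      proof (rule sum_norm_le, clarify)
        fix x k assume "(x, k) \<in> D"
        then have "x \<in> cbox a b" using tagged_division_ofD(2,3)[OF D] by blast
        then show "norm (measure lborel k *\<^sub>R (s n x - g x)) \<le> measure lborel k *\<^sub>R \<phi> n x"
          using le[of x n] by (simp add: mult_left_mono)
      qed
      finally have "norm ((\<Sum>(x, k)\<in>D. measure lborel k *\<^sub>R s n x) - (\<Sum>(x, k)\<in>D. measure lborel k *\<^sub>R g x))
        \<le> (\<Sum>(x, k)\<in>D. measure lborel k *\<^sub>R \<phi> n x)" .
      also have "\<dots> < e / 2"
        using R2[OF D f(2)] n(1) unfolding real_norm_def by linarith
      finally have "norm ((\<Sum>(x, k)\<in>D. measure lborel k *\<^sub>R g x) - (\<Sum>(x, k)\<in>D. measure lborel k *\<^sub>R s n x)) < e / 2"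
        by (simp only: norm_minus_commute)
      from norm_diff_triangle_less[OF norm_diff_triangle_less[OF this R1[OF D f(1)]] n(2)]
      show "norm ((\<Sum>(x, k)\<in>D. measure lborel k *\<^sub>R g x) - I) < e" by simp
    qed
  qed
  then show ?thesis by blast
qed

lemma simple_function_integrable_on:
  fixes s :: "'n::euclidean_space \<Rightarrow> 'a::real_normed_vector"
  assumes "simple_function lebesgue s"
  shows "s integrable_on cbox a b"
proof -
  have fin: "finite (range s)" and fib: "\<And>y. s -` {y} \<in> sets lebesgue"
    using assms simple_functionD[OF assms] by auto
  have "s x = (\<Sum>y\<in>range s. indicat_real (s -` {y}) x *\<^sub>R y)" for x
  proof -
    have "(\<Sum>y\<in>range s. indicat_real (s -` {y}) x *\<^sub>R y) = (\<Sum>y\<in>range s. if y = s x then y else 0)"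
      by (intro sum.cong) (auto simp: indicator_def)
    then show ?thesis using fin by simp
  qed
  moreover have "(\<lambda>x. \<Sum>y\<in>range s. indicat_real (s -` {y}) x *\<^sub>R y) integrable_on cbox a b"
  proof (intro integrable_sum fin)
    fix y
    have "indicat_real (s -` {y}) integrable_on cbox a b"
      by (rule measurable_bounded_lemma[where g="\<lambda>_. 1"]) (use fib in \<open>auto simp: indicator_def\<close>)
    then show "(\<lambda>x. indicat_real (s -` {y}) x *\<^sub>R y) integrable_on cbox a b"
      by (rule integrable_on_scaleR_left)
  qed
  ultimately show ?thesis by (metis (no_types, lifting) integrable_cong)
qed


lemma bounded_convergence_to_zero:
  fixes \<phi> :: "nat \<Rightarrow> 'n::euclidean_space \<Rightarrow> real"
  assumes m: "\<And>n. \<phi> n \<in> borel_measurable lebesgue"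
    and B: "\<And>n x. x \<in> cbox a b \<Longrightarrow> \<bar>\<phi> n x\<bar> \<le> B"
    and lim: "AE x in lebesgue. x \<in> cbox a b \<longrightarrow> (\<lambda>n. \<phi> n x) \<longlonglongrightarrow> 0"
  shows "(\<lambda>n. integral (cbox a b) (\<phi> n)) \<longlonglongrightarrow> 0"
proof -
  let ?M = "lebesgue_on (cbox a b)"
  have B': "norm (\<phi> n x) \<le> B" if "x \<in> cbox a b" for n x using B[OF that] by simp
  have mM: "\<phi> n \<in> borel_measurable ?M" for n using m by (rule measurable_restrict_space1)
  have c: "integrable ?M (\<lambda>_. B)"
    using absolutely_integrable_continuous[of a b "\<lambda>_. B"]
    by (simp add: integrable_restrict_space set_integrable_def)
  have i: "integrable ?M (\<phi> n)" for n
  proof (rule Bochner_Integration.integrable_bound[OF c mM])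
    show "AE x in ?M. norm (\<phi> n x) \<le> norm B"
      using B' by (intro AE_I2) (simp add: space_restrict_space, meson abs_ge_self order_trans)
  qed
  have "(\<lambda>n. integral\<^sup>L ?M (\<phi> n)) \<longlonglongrightarrow> integral\<^sup>L ?M (\<lambda>_. 0)"
  proof (rule integral_dominated_convergence[OF _ mM c])
    show "AE x in ?M. (\<lambda>n. \<phi> n x) \<longlonglongrightarrow> 0"
      using lim by (simp add: AE_restrict_space_iff)
    show "AE x in ?M. norm (\<phi> n x) \<le> B" for n
      using B' by (auto intro!: AE_I2 simp: space_restrict_space)
  qed simp
  moreover have "integral\<^sup>L ?M (\<phi> n) = integral (cbox a b) (\<phi> n)" for n
    by (rule lebesgue_integral_eq_integral[OF i]) simp
  ultimately show ?thesis by simp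
qed

lemma bounded_measurable_integrable_on:
  fixes \<phi> :: "'n::euclidean_space \<Rightarrow> real"
  assumes "\<phi> \<in> borel_measurable lebesgue" and "\<And>x. x \<in> cbox a b \<Longrightarrow> \<bar>\<phi> x\<bar> \<le> B"
  shows "\<phi> integrable_on cbox a b"
  by (rule measurable_bounded_lemma[where g="\<lambda>_. B"]) (use assms in auto)

lemma simple_function_imp_strongly_measurable:
  "simple_function M s \<Longrightarrow> strongly_measurable M s"
  unfolding strongly_measurable_def by (intro exI[of _ "\<lambda>_. s"]) auto

lemma strongly_measurable_diff:
  fixes g h :: "'a \<Rightarrow> 'b::real_normed_vector"
  assumes "strongly_measurable M g" and "strongly_measurable M h"
  shows "strongly_measurable M (\<lambda>t. g t - h t)"
  using strongly_measurable_isCont[OF strongly_measurable_Pair[OF assms], of "\<lambda>p. fst p - snd p"]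
  by (auto intro: continuous_intros)

text \<open>
  The approximating simple functions need not be bounded uniformly. Values of norm greater than
  \<open>\<bar>B\<bar> + 1\<close> are replaced by \<open>0\<close>, which does not affect the limit and makes the error bounded.
\<close>

lemma strongly_measurable_integrable_on:
  fixes g :: "real \<Rightarrow> 'a::banach"
  assumes g: "strongly_measurable lebesgue g" and B: "\<And>x. x \<in> {a..b} \<Longrightarrow> norm (g x) \<le> B"
  shows "g integrable_on {a..b}"
proof -
  obtain s where s: "\<And>n. simple_function lebesgue (s n)" "AE x in lebesgue. (\<lambda>n. s n x) \<longlonglongrightarrow> g x"
    using g unfolding strongly_measurable_def by blast
  define tr where "tr y = (if norm y \<le> \<bar>B\<bar> + 1 then y else 0)" for y :: 'a
  define \<phi> where "\<phi> n x = norm (tr (s n x) - g x)" for n x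
  have tr: "norm (tr y) \<le> \<bar>B\<bar> + 1" for y by (auto simp: tr_def)
  have st: "simple_function lebesgue (\<lambda>x. tr (s n x))" for n
    using s(1) by (rule simple_function_compose1)
  have m: "\<phi> n \<in> borel_measurable lebesgue" for n
    unfolding \<phi>_def
    by (intro strongly_measurable_norm strongly_measurable_diff g simple_function_imp_strongly_measurable st)
  have bd: "\<bar>\<phi> n x\<bar> \<le> 2 * \<bar>B\<bar> + 1" if "x \<in> cbox a b" for n x
    using norm_triangle_ineq4[of "tr (s n x)" "g x"] tr[of "s n x"] B[of x] that by (auto simp: \<phi>_def)
  have "AE x in lebesgue. x \<in> cbox a b \<longrightarrow> (\<lambda>n. \<phi> n x) \<longlonglongrightarrow> 0"
    using s(2)
  proof eventually_elim
    case (elim x)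
    show ?case
    proof
      assume x: "x \<in> cbox a b"
      have "\<forall>\<^sub>F n in sequentially. norm (s n x) < \<bar>B\<bar> + 1"
        using B[of x] x by (intro order_tendstoD(2)[OF tendsto_norm[OF elim]]) auto
      then have "\<forall>\<^sub>F n in sequentially. s n x = tr (s n x)"
        by eventually_elim (auto simp: tr_def)
      then have "(\<lambda>n. tr (s n x)) \<longlonglongrightarrow> g x" using elim by (rule Lim_transform_eventually[rotated])
      then show "(\<lambda>n. \<phi> n x) \<longlonglongrightarrow> 0" unfolding \<phi>_def
        by (intro tendsto_norm_zero LIM_zero)
    qed
  qed
  then have r: "(\<lambda>n. integral (cbox a b) (\<phi> n)) \<longlonglongrightarrow> 0"
    using m bd by (intro bounded_convergence_to_zero) 
  have "g integrable_on cbox a b"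
  proof (rule has_integral_L1_limit[where s="\<lambda>n x. tr (s n x)", OF _ _ _ r])
    show "((\<lambda>x. tr (s n x)) has_integral integral (cbox a b) (\<lambda>x. tr (s n x))) (cbox a b)" for n
      using simple_function_integrable_on[OF st] by (rule integrable_integral)
    show "(\<phi> n has_integral integral (cbox a b) (\<phi> n)) (cbox a b)" for n
      using bounded_measurable_integrable_on[OF m bd] by (rule integrable_integral)
  qed (simp add: \<phi>_def)
  then show ?thesis by simp
qed

lemma strongly_measurable_norm_integrable_on:
  fixes g :: "real \<Rightarrow> 'a::banach"
  assumes g: "strongly_measurable lebesgue g" and B: "\<And>x. x \<in> {a..b} \<Longrightarrow> norm (g x) \<le> B"
  shows "(\<lambda>t. norm (g t)) integrable_on {a..b}"
  using bounded_measurable_integrable_on[OF strongly_measurable_norm[OF g], of a b B] B by simp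

lemma strongly_measurable_bounded_convergence:
  fixes h :: "real \<Rightarrow> 'a::banach"
  assumes hn: "\<And>n. strongly_measurable lebesgue (hn n)" and h: "strongly_measurable lebesgue h"
    and Bn: "\<And>n x. x \<in> {a..b} \<Longrightarrow> norm (hn n x) \<le> B" and B: "\<And>x. x \<in> {a..b} \<Longrightarrow> norm (h x) \<le> B"
    and lim: "AE x in lebesgue. x \<in> {a..b} \<longrightarrow> (\<lambda>n. hn n x) \<longlonglongrightarrow> h x"
  shows "(\<lambda>n. integral {a..b} (\<lambda>t. norm (hn n t - h t))) \<longlonglongrightarrow> 0"
    and "(\<lambda>n. integral {a..b} (hn n)) \<longlonglongrightarrow> integral {a..b} h"
proof -
  have bd: "norm (hn n x - h x) \<le> 2 * B" if "x \<in> {a..b}" for n x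
    using norm_triangle_ineq4[of "hn n x" "h x"] Bn[OF that, of n] B[OF that] by simp
  have "(\<lambda>n. integral (cbox a b) (\<lambda>t. norm (hn n t - h t))) \<longlonglongrightarrow> 0"
  proof (rule bounded_convergence_to_zero[where B="2 * B"])
    show "AE x in lebesgue. x \<in> cbox a b \<longrightarrow> (\<lambda>n. norm (hn n x - h x)) \<longlonglongrightarrow> 0"
      using lim by eventually_elim (auto intro: tendsto_norm_zero LIM_zero)
    show "(\<lambda>t. norm (hn n t - h t)) \<in> borel_measurable lebesgue" for n
      by (intro strongly_measurable_norm strongly_measurable_diff hn h)
  qed (use bd in auto)
  then show L: "(\<lambda>n. integral {a..b} (\<lambda>t. norm (hn n t - h t))) \<longlonglongrightarrow> 0" by simp
  have I: "hn n integrable_on {a..b}" "h integrable_on {a..b}" for n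
    using strongly_measurable_integrable_on hn h Bn B by blast+
  have "norm (integral {a..b} (hn n) - integral {a..b} h) \<le> integral {a..b} (\<lambda>t. norm (hn n t - h t))" for n
    unfolding Henstock_Kurzweil_Integration.integral_diff[OF I, symmetric]
    using strongly_measurable_norm_integrable_on[OF strongly_measurable_diff[OF hn h] bd]
    by (intro integral_norm_bound_integral integrable_diff I) auto
  then have "(\<lambda>n. integral {a..b} (hn n) - integral {a..b} h) \<longlonglongrightarrow> 0"
    using L by (rule Lim_null_comparison[OF always_eventually[OF allI]])
  then show "(\<lambda>n. integral {a..b} (hn n)) \<longlonglongrightarrow> integral {a..b} h" by (rule LIM_zero_cancel)
qed

section \<open>Strongly continuous semigroups\<close>

text \<open>
  The Banach--Steinhaus theorem for sequences, by Baire's theorem: one of the closed sets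
  \<open>{x. \<forall>n. norm (A n x) \<le> k}\<close> contains a ball, and every small vector is the difference of two points
  of that ball.
\<close>

lemma uniform_boundedness:
  fixes A :: "nat \<Rightarrow> 'a::banach \<Rightarrow>\<^sub>L 'b::real_normed_vector"
  assumes pt: "\<And>x. bounded (range (\<lambda>n. A n x))"
  obtains C where "\<And>n. norm (A n) \<le> C"
proof -
  define F where "F k = {x. \<forall>n. norm (A n x) \<le> real k}" for k :: nat
  have cl: "closed (F k)" for k
    unfolding F_def by (intro closed_Collect_all closed_Collect_le continuous_intros)
  have "(\<Union>k. F k) = UNIV"
  proof -
    have "x \<in> (\<Union>k. F k)" for x
    proof -
      obtain r where r: "\<And>n. norm (A n x) \<le> r" using pt[of x] by (auto simp: bounded_iff)
      obtain k :: nat where "r \<le> real k" using real_arch_simple by blast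
      then have "x \<in> F k" using r by (auto simp: F_def intro: order_trans)
      then show ?thesis by blast
    qed
    then show ?thesis by blast
  qed
  moreover have "interior (\<Union>k. F k) = {}" if "\<And>k. interior (F k) = {}"
    using Baire_category_alt[OF disjI1[OF completely_metrizable_space_euclidean], of "range F"] cl that
    by (auto simp flip: closed_closedin)
  ultimately have "\<exists>k. interior (F k) \<noteq> {}"
    by (metis interior_UNIV UNIV_not_empty)
  then obtain k x0 e where e: "e > 0" "ball x0 e \<subseteq> F k"
    by (metis ex_in_conv mem_interior)
  \<comment> \<open>\<open>z\<close> is the difference of \<open>x0 + z\<close> and \<open>x0\<close>, both in \<open>F k\<close>\<close>
  have small: "norm (A n z) \<le> 2 * real k" if "norm z < e" for n z
  proof -
    have "x0 + z \<in> F k" "x0 \<in> F k" using e that by (auto simp: subset_iff dist_norm)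
    then have "norm (A n (x0 + z)) \<le> real k" "norm (A n x0) \<le> real k" by (auto simp: F_def)
    moreover have "A n z = A n (x0 + z) - A n x0" by (simp add: blinfun.add_right)
    ultimately show ?thesis using norm_triangle_ineq4[of "A n (x0 + z)" "A n x0"] by simp
  qed
  have "norm (A n) \<le> 4 * real k / e" for n
  proof (rule norm_blinfun_bound)
    fix x
    show "norm (A n x) \<le> 4 * real k / e * norm x"
    proof (cases "x = 0")
      case False
      \<comment> \<open>the factor \<open>1/2\<close> puts the rescaled vector strictly inside the ball of radius \<open>e\<close>\<close>
      have "norm (A n ((e / 2 / norm x) *\<^sub>R x)) \<le> 2 * real k"
        using e False by (intro small) simp
      then show ?thesis using False e
        by (simp add: blinfun.scaleR_right field_simps)
    qed simp
  qed (use e in simp)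
  then show thesis using that by blast
qed

text \<open>
  Strong continuity at \<open>0\<close> and the uniform boundedness principle give a bound near \<open>0\<close>. Advancing in steps of a
  fixed length multiplies this bound by a constant each time.
\<close>

lemma C0_semigroup_bounded:
  fixes S :: "real \<Rightarrow> 'y::banach \<Rightarrow>\<^sub>L 'y"
  assumes S: "C0_semigroup S"
  obtains M where "M \<ge> 1" "\<And>t. t \<in> {0..T} \<Longrightarrow> norm (S t) \<le> M"
proof -
  have S0: "S 0 = id_blinfun" and Sadd: "\<And>s t. s \<ge> 0 \<Longrightarrow> t \<ge> 0 \<Longrightarrow> S (s + t) = S s o\<^sub>L S t"
    and Slim: "\<And>x. ((\<lambda>t. S t x) \<longlongrightarrow> x) (at_right 0)"
    using S by (auto simp: C0_semigroup_def)
  have "\<exists>\<delta>>0. \<exists>C. \<forall>t\<in>{0<..<\<delta>}. norm (S t) \<le> C"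
  proof (rule ccontr)
    assume "\<not> ?thesis"
    then have "\<exists>t\<in>{0<..<\<delta>}. norm (S t) > C" if "\<delta> > 0" for \<delta> C using that by (meson not_le)
    from this[of "inverse (real (Suc n))" "real n" for n] obtain t where
      t: "\<And>n. t n \<in> {0<..<inverse (real (Suc n))}" "\<And>n. norm (S (t n)) > real n"
      by (metis inverse_positive_iff_positive of_nat_0_less_iff zero_less_Suc)
    have "t \<longlonglongrightarrow> 0"
      by (rule tendsto_sandwich[OF _ _ tendsto_const LIMSEQ_inverse_real_of_nat])
        (use t(1) in \<open>auto intro!: always_eventually simp: less_imp_le\<close>)
    then have "filterlim t (at_right 0) sequentially"
      using t(1) by (auto simp: filterlim_at less_imp_neq[symmetric] intro!: always_eventually)
    then have "(\<lambda>n. S (t n) x) \<longlonglongrightarrow> x" for x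
      using Slim filterlim_compose by blast
    then have "bounded (range (\<lambda>n. S (t n) x))" for x
      by (rule convergent_imp_bounded)
    then obtain C where "\<And>n. norm (S (t n)) \<le> C"
      using uniform_boundedness[of "\<lambda>n. S (t n)"] by blast
    moreover obtain n :: nat where "C \<le> real n" using real_arch_simple by blast
    ultimately show False using t(2)[of n] by (meson not_le order_trans)
  qed
  then obtain \<delta> C where \<delta>: "\<delta> > 0" and C: "\<And>t. t \<in> {0<..<\<delta>} \<Longrightarrow> norm (S t) \<le> C" by blast
  define B where "B = max 1 C"
  have B: "B \<ge> 1" by (simp add: B_def)
  have sm: "norm (S t) \<le> B" if "0 \<le> t" "t < \<delta>" for t
    using C[of t] that S0 norm_blinfun_id_le by (cases "t = 0") (auto simp: B_def le_max_iff_disj)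
  have "norm (S t) \<le> B ^ Suc n" if "0 \<le> t" "t \<le> real n * (\<delta> / 2)" for n t
    using that
  proof (induction n arbitrary: t)
    case 0
    then show ?case using sm[of t] \<delta> by simp
  next
    case (Suc n)
    show ?case
    proof (cases "t < \<delta> / 2")
      case True
      then have "norm (S t) \<le> B" using sm[of t] Suc.prems \<delta> by simp
      also have "B \<le> B ^ Suc (Suc n)" using B by (metis One_nat_def Suc_le_mono le0 power_increasing power_one_right)
      finally show ?thesis .
    next
      case False
      have "S t = S (\<delta> / 2) o\<^sub>L S (t - \<delta> / 2)" using Sadd[of "\<delta>/2" "t - \<delta>/2"] False \<delta> by simp
      then have "norm (S t) \<le> norm (S (\<delta> / 2)) * norm (S (t - \<delta> / 2))"
        by (simp add: norm_blinfun_compose)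
      also have "\<dots> \<le> B * B ^ Suc n"
        using B False Suc.prems \<delta> by (intro mult_mono sm Suc.IH) (auto simp: algebra_simps)
      finally show ?thesis by simp
    qed
  qed note bd = this
  obtain n :: nat where n: "T / (\<delta> / 2) \<le> real n" using real_arch_simple by blast
  show thesis
  proof (rule that)
    show "B ^ Suc n \<ge> 1" using B by (rule one_le_power)
    show "norm (S t) \<le> B ^ Suc n" if "t \<in> {0..T}" for t
      using bd[of t n] that n \<delta> by (auto simp: field_simps)
  qed
qed

text \<open>
  For \<open>s \<le> t\<close> the increment is \<open>S t x - S s x = S s (S (t - s) x - x)\<close>, so the bound on \<open>S\<close> reduces
  two-sided continuity at every time to continuity from the right at \<open>0\<close>.
\<close>

lemma C0_semigroup_orbit_continuous:
  fixes S :: "real \<Rightarrow> 'y::banach \<Rightarrow>\<^sub>L 'y"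
  assumes S: "C0_semigroup S"
  shows "continuous_on {0..T} (\<lambda>t. S t x)"
proof -
  obtain M where M: "M \<ge> 1" "\<And>t. t \<in> {0..T} \<Longrightarrow> norm (S t) \<le> M"
    using C0_semigroup_bounded[OF S] by blast
  have S0: "S 0 = id_blinfun" and Sadd: "\<And>s t. s \<ge> 0 \<Longrightarrow> t \<ge> 0 \<Longrightarrow> S (s + t) = S s o\<^sub>L S t"
    and Slim: "((\<lambda>t. S t x) \<longlongrightarrow> x) (at_right 0)"
    using S by (auto simp: C0_semigroup_def)
  have mono: "norm (S t x - S s x) \<le> M * norm (S (t - s) x - x)" if "0 \<le> s" "s \<le> t" "t \<le> T" for s t
  proof -
    have "S t x - S s x = S s (S (t - s) x - x)"
      using Sadd[of s "t - s"] that by (simp add: blinfun.diff_right)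
    also have "norm \<dots> \<le> norm (S s) * norm (S (t - s) x - x)" by (rule norm_blinfun)
    also have "\<dots> \<le> M * norm (S (t - s) x - x)" using M(2)[of s] that by (intro mult_right_mono) auto
    finally show ?thesis .
  qed
  show ?thesis
    unfolding continuous_on_iff
  proof (intro ballI allI impI)
    fix t e :: real assume t: "t \<in> {0..T}" and e: "e > 0"
    have "\<forall>\<^sub>F h in at_right 0. dist (S h x) x < e / M"
      using Slim e M by (intro tendstoD) auto
    then obtain d where d: "d > 0" "\<And>h. 0 < h \<Longrightarrow> h < d \<Longrightarrow> dist (S h x) x < e / M"
      unfolding eventually_at_right_field by auto
    have d': "M * norm (S h x - x) < e" if "0 \<le> h" "h < d" for h
      using d(2)[of h] that M e S0 by (cases "h = 0") (auto simp: dist_norm field_simps)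
    show "\<exists>d>0. \<forall>s\<in>{0..T}. dist s t < d \<longrightarrow> dist (S s x) (S t x) < e"
    proof (intro exI[of _ d] conjI ballI impI d(1))
      fix s assume s: "s \<in> {0..T}" "dist s t < d"
      show "dist (S s x) (S t x) < e"
      proof (cases "s \<le> t")
        case True
        then show ?thesis using mono[of s t] d'[of "t - s"] s t
          by (simp add: dist_norm norm_minus_commute)
      next
        case False
        then show ?thesis using mono[of t s] d'[of "s - t"] s t
          by (simp add: dist_norm)
      qed
    qed
  qed
qed

text \<open>
  Extending the semigroup by zero to negative times makes the domain of integration in the
  Duhamel formula independent of \<open>t\<close>. The jump at \<open>0\<close> falls on a null set.
\<close>

definition propagator :: "(real \<Rightarrow> 'y::real_normed_vector \<Rightarrow>\<^sub>L 'y) \<Rightarrow> real \<Rightarrow> 'y \<Rightarrow>\<^sub>L 'y" where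
  "propagator S \<sigma> = (if \<sigma> \<ge> 0 then S \<sigma> else 0)"

lemma C0_semigroup_jointly_continuous:
  fixes S :: "real \<Rightarrow> 'y::banach \<Rightarrow>\<^sub>L 'y"
  assumes S: "C0_semigroup S"
  shows "continuous_on ({0..T} \<times> UNIV) (\<lambda>(t, x). S t x)"
proof -
  obtain M where M: "M \<ge> 1" "\<And>t. t \<in> {0..T} \<Longrightarrow> norm (S t) \<le> M"
    using C0_semigroup_bounded[OF S] by blast
  show ?thesis
  proof (rule continuous_on_sequentiallyI)
    fix p :: "nat \<Rightarrow> real \<times> 'y" and q
    assume p: "\<forall>n. p n \<in> {0..T} \<times> UNIV" and q: "q \<in> {0..T} \<times> UNIV" and lim: "p \<longlonglongrightarrow> q"
    define s z where "s n = fst (p n)" and "z n = snd (p n)" for n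
    have s: "s n \<in> {0..T}" for n using p by (auto simp: s_def mem_Times_iff)
    have sl: "s \<longlonglongrightarrow> fst q" and zl: "z \<longlonglongrightarrow> snd q"
      using tendsto_fst[OF lim] tendsto_snd[OF lim] unfolding s_def z_def by auto
    have "(\<lambda>n. S (s n) (snd q)) \<longlonglongrightarrow> S (fst q) (snd q)"
      using continuous_on_tendsto_compose[OF C0_semigroup_orbit_continuous[OF S] sl, of T] s q
      by (auto simp: mem_Times_iff)
    moreover have "(\<lambda>n. S (s n) (z n - snd q)) \<longlonglongrightarrow> 0"
    proof (rule Lim_null_comparison)
      have "norm (S (s n) (z n - snd q)) \<le> M * norm (z n - snd q)" for n
        by (rule order_trans[OF norm_blinfun mult_right_mono[OF M(2)[OF s]]]) simp
      then show "\<forall>\<^sub>F n in sequentially. norm (S (s n) (z n - snd q)) \<le> M * norm (z n - snd q)"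
        by simp
      have "(\<lambda>n. norm (z n - snd q)) \<longlonglongrightarrow> 0" using zl by (intro tendsto_norm_zero LIM_zero)
      then show "(\<lambda>n. M * norm (z n - snd q)) \<longlonglongrightarrow> 0" by (rule tendsto_mult_right_zero)
    qed
    ultimately have "(\<lambda>n. S (s n) (snd q) + S (s n) (z n - snd q)) \<longlonglongrightarrow> S (fst q) (snd q) + 0"
      by (rule tendsto_add)
    then show "(\<lambda>n. (\<lambda>(t, x). S t x) (p n)) \<longlonglongrightarrow> (\<lambda>(t, x). S t x) q"
      by (simp add: s_def z_def split_def blinfun.diff_right)
  qed
qed

lemma propagator_isCont:
  fixes S :: "real \<Rightarrow> 'y::banach \<Rightarrow>\<^sub>L 'y"
  assumes S: "C0_semigroup S" and "\<sigma> \<noteq> 0"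
  shows "isCont (\<lambda>(s, z). propagator S s z) (\<sigma>, x)"
proof (cases "\<sigma> > 0")
  case True
  have "continuous_on ({0..\<sigma> + 1} \<times> UNIV) (\<lambda>(s, z). propagator S s z)"
    using C0_semigroup_jointly_continuous[OF S, of "\<sigma> + 1"]
    by (rule continuous_on_eq) (auto simp: propagator_def)
  then show ?thesis
    by (rule continuous_on_interior) (use True in \<open>simp add: interior_Times\<close>)
next
  case False
  have "continuous_on ({..<0} \<times> UNIV) (\<lambda>(s, z). propagator S s z)"
    by (rule continuous_on_eq[OF continuous_on_const[of _ 0]]) (auto simp: propagator_def)
  then show ?thesis
    by (rule continuous_on_interior) (use False assms(2) in \<open>simp add: interior_Times interior_open\<close>)
qed

lemma propagator_norm_le:
  assumes M: "\<And>t. t \<in> {0..T} \<Longrightarrow> norm (S t) \<le> M" "M \<ge> 0" and "\<sigma> \<le> T"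
  shows "norm (propagator S \<sigma> x) \<le> M * norm x"
proof (cases "\<sigma> \<ge> 0")
  case True
  then show ?thesis
    using order_trans[OF norm_blinfun mult_right_mono[OF M(1)[of \<sigma>]]] assms(3)
    by (simp add: propagator_def)
qed (use M in \<open>simp add: propagator_def\<close>)

section \<open>The Duhamel integral\<close>

definition duhamel :: "(real \<Rightarrow> 'y::banach \<Rightarrow>\<^sub>L 'y) \<Rightarrow> real \<Rightarrow> (real \<Rightarrow> 'y) \<Rightarrow> real \<Rightarrow> 'y" where
  "duhamel S T h t = integral {0..T} (\<lambda>\<tau>. propagator S (t - \<tau>) (h \<tau>))"

lemma AE_lebesgue_neq: "AE \<tau> in lebesgue. \<tau> \<noteq> (t :: real)"
  by (intro AE_completion AE_lborel_singleton)

lemma strongly_measurable_duhamel_integrand: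
  fixes S :: "real \<Rightarrow> 'y::banach \<Rightarrow>\<^sub>L 'y"
  assumes S: "C0_semigroup S" and h: "strongly_measurable lebesgue h"
  shows "strongly_measurable lebesgue (\<lambda>\<tau>. propagator S (t - \<tau>) (h \<tau>))"
proof -
  have *: "strongly_measurable lebesgue (\<lambda>\<tau>. (t - \<tau>, h \<tau>))"
    by (intro strongly_measurable_Pair h strongly_measurable_continuous continuous_intros)
  have "AE \<tau> in lebesgue. isCont (\<lambda>(s, z). propagator S s z) (t - \<tau>, h \<tau>)"
    using AE_lebesgue_neq[of t] by eventually_elim (simp add: propagator_isCont[OF S])
  from strongly_measurable_isCont[OF * this] show ?thesis by simp
qed

lemma duhamel_has_integral:
  fixes S :: "real \<Rightarrow> 'y::banach \<Rightarrow>\<^sub>L 'y"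
  assumes S: "C0_semigroup S" and h: "strongly_measurable lebesgue h"
    and B: "\<And>\<tau>. \<tau> \<in> {0..T} \<Longrightarrow> norm (h \<tau>) \<le> B" and t: "t \<in> {0..T}"
  shows "((\<lambda>\<tau>. S (t - \<tau>) (h \<tau>)) has_integral duhamel S T h t) {0..t}"
proof -
  obtain M where M: "M \<ge> 1" "\<And>t. t \<in> {0..T} \<Longrightarrow> norm (S t) \<le> M"
    using C0_semigroup_bounded[OF S] by blast
  have "norm (propagator S (t - \<tau>) (h \<tau>)) \<le> M * B" if "\<tau> \<in> {0..T}" for \<tau>
    using order_trans[OF propagator_norm_le[where S=S and T=T and M=M] mult_left_mono[OF B[OF that], of M]]
      M t that by auto
  then have "((\<lambda>\<tau>. propagator S (t - \<tau>) (h \<tau>)) has_integral duhamel S T h t) {0..T}"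
    unfolding duhamel_def
    by (intro integrable_integral strongly_measurable_integrable_on
        strongly_measurable_duhamel_integrand[OF S h])
  then have "((\<lambda>\<tau>. if \<tau> \<in> cbox 0 t then S (t - \<tau>) (h \<tau>) else 0) has_integral duhamel S T h t) (cbox 0 T)"
    unfolding cbox_interval by (rule has_integral_eq[rotated]) (auto simp: propagator_def)
  then show ?thesis
    using t by (subst (asm) has_integral_restrict_closed_subintervals_eq) auto
qed

text \<open>
  Both the kernel and the domain of integration vary with \<open>t\<close>. Written with \<open>propagator\<close> over the
  fixed interval \<open>{0..T}\<close>, the integrands converge for \<open>\<tau> \<noteq> t\<close> and are bounded.
\<close>

lemma duhamel_continuous:
  fixes S :: "real \<Rightarrow> 'y::banach \<Rightarrow>\<^sub>L 'y"
  assumes S: "C0_semigroup S" and h: "strongly_measurable lebesgue h"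
    and B: "\<And>\<tau>. \<tau> \<in> {0..T} \<Longrightarrow> norm (h \<tau>) \<le> B"
  shows "continuous_on {0..T} (duhamel S T h)"
proof (rule continuous_on_sequentiallyI)
  fix s :: "nat \<Rightarrow> real" and t
  assume s: "\<forall>n. s n \<in> {0..T}" and t: "t \<in> {0..T}" and lim: "s \<longlonglongrightarrow> t"
  obtain M where M: "M \<ge> 1" "\<And>t. t \<in> {0..T} \<Longrightarrow> norm (S t) \<le> M"
    using C0_semigroup_bounded[OF S] by blast
  have bd: "norm (propagator S (r - \<tau>) (h \<tau>)) \<le> M * B" if "r \<in> {0..T}" "\<tau> \<in> {0..T}" for r \<tau>
    using order_trans[OF propagator_norm_le[where S=S and T=T and M=M] mult_left_mono[OF B[OF that(2)], of M]]
      M that by auto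
  have "AE \<tau> in lebesgue. \<tau> \<in> {0..T} \<longrightarrow>
      (\<lambda>n. propagator S (s n - \<tau>) (h \<tau>)) \<longlonglongrightarrow> propagator S (t - \<tau>) (h \<tau>)"
    using AE_lebesgue_neq[of t]
  proof eventually_elim
    case (elim \<tau>)
    have "(\<lambda>n. (s n - \<tau>, h \<tau>)) \<longlonglongrightarrow> (t - \<tau>, h \<tau>)"
      by (intro tendsto_intros lim)
    from isCont_tendsto_compose[OF propagator_isCont[OF S, of "t - \<tau>" "h \<tau>"] this] elim
    show ?case by simp
  qed
  then show "(\<lambda>n. duhamel S T h (s n)) \<longlonglongrightarrow> duhamel S T h t"
    unfolding duhamel_def using bd s t
    by (intro strongly_measurable_bounded_convergence(2)[where B="M * B"]
        strongly_measurable_duhamel_integrand[OF S h]) auto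
qed

lemma duhamel_integral_diff_le:
  fixes S :: "real \<Rightarrow> 'y::banach \<Rightarrow>\<^sub>L 'y"
  assumes M: "\<And>t. t \<in> {0..T} \<Longrightarrow> norm (S t) \<le> M" "M \<ge> 0" and t: "t \<in> {0..T}"
    and I: "((\<lambda>\<tau>. S (t - \<tau>) (a \<tau>)) has_integral I) {0..t}"
    and J: "((\<lambda>\<tau>. S (t - \<tau>) (b \<tau>)) has_integral J) {0..t}"
    and le: "\<And>\<tau>. \<tau> \<in> {0..t} \<Longrightarrow> norm (a \<tau> - b \<tau>) \<le> \<phi> \<tau>" and \<phi>: "\<phi> integrable_on {0..t}"
  shows "norm (I - J) \<le> M * integral {0..t} \<phi>"
proof -
  have d: "((\<lambda>\<tau>. S (t - \<tau>) (a \<tau>) - S (t - \<tau>) (b \<tau>)) has_integral I - J) {0..t}"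
    by (rule has_integral_diff[OF I J])
  have "norm (S (t - \<tau>) (a \<tau>) - S (t - \<tau>) (b \<tau>)) \<le> M * \<phi> \<tau>" if "\<tau> \<in> {0..t}" for \<tau>
  proof -
    have "norm (S (t - \<tau>) (a \<tau> - b \<tau>)) \<le> norm (S (t - \<tau>)) * norm (a \<tau> - b \<tau>)" by (rule norm_blinfun)
    also have "\<dots> \<le> M * \<phi> \<tau>" using M t that le by (intro mult_mono) auto
    finally show ?thesis by (simp add: blinfun.diff_right)
  qed
  moreover have "(\<lambda>\<tau>. M * \<phi> \<tau>) integrable_on {0..t}"
    using \<phi> by (rule integrable_on_mult_right)
  ultimately have "norm (integral {0..t} (\<lambda>\<tau>. S (t - \<tau>) (a \<tau>) - S (t - \<tau>) (b \<tau>)))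
      \<le> integral {0..t} (\<lambda>\<tau>. M * \<phi> \<tau>)"
    using d by (intro integral_norm_bound_integral) auto
  then show ?thesis using d by (simp add: integral_unique)
qed

section \<open>Existence and stability of mild solutions\<close>

text \<open>
  The exponent \<open>2 * C\<close> is chosen such that the Volterra operator \<open>d \<mapsto> C * \<integral> d\<close> has norm at most
  \<open>1/2\<close> for the weight \<open>exp (2 * C * t)\<close>. Both Gronwall's lemma and the contraction argument for
  existence rest on this.
\<close>

lemma exp_weight_integral_le:
  fixes d :: "real \<Rightarrow> real"
  assumes C: "C > 0" and m: "m \<ge> 0" and s: "s \<ge> 0" and d: "d integrable_on {0..s}"
    and le: "\<And>\<tau>. \<tau> \<in> {0..s} \<Longrightarrow> d \<tau> \<le> m * exp (2 * C * \<tau>)"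
  shows "C * integral {0..s} d \<le> m / 2 * exp (2 * C * s)"
proof -
  have "((\<lambda>\<tau>. m * exp (2 * C * \<tau>)) has_integral
      m * exp (2 * C * s) / (2 * C) - m * exp (2 * C * 0) / (2 * C)) {0..s}"
    using C s by (intro fundamental_theorem_of_calculus)
      (auto intro!: derivative_eq_intros simp flip: has_real_derivative_iff_has_vector_derivative)
  then have "integral {0..s} d \<le> m * exp (2 * C * s) / (2 * C) - m / (2 * C)"
    using has_integral_le[OF integrable_integral[OF d]] le by simp
  also have "\<dots> \<le> m * exp (2 * C * s) / (2 * C)" using m C by simp
  finally have "integral {0..s} d \<le> m * exp (2 * C * s) / (2 * C)" .
  then show ?thesis using C by (simp add: field_simps)
qed

text \<open>
  At a maximum \<open>s\<close> of \<open>exp (-2 * C * t) * d t\<close> the integral term accounts for at most half of the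
  maximum, so the maximum is at most \<open>2 * \<delta>\<close>.
\<close>

lemma gronwall:
  fixes d :: "real \<Rightarrow> real"
  assumes C: "C > 0" and cont: "continuous_on {0..T} d" and nonneg: "\<And>t. t \<in> {0..T} \<Longrightarrow> d t \<ge> 0"
    and le: "\<And>t. t \<in> {0..T} \<Longrightarrow> d t \<le> \<delta> + C * integral {0..t} d" and t: "t \<in> {0..T}"
    and \<delta>: "\<delta> \<ge> 0"
  shows "d t \<le> 2 * \<delta> * exp (2 * C * t)"
proof -
  define e where "e t = exp (- (2 * C * t)) * d t" for t
  have "continuous_on {0..T} e" unfolding e_def by (intro continuous_intros cont)
  then obtain s where s: "s \<in> {0..T}" and max: "\<And>r. r \<in> {0..T} \<Longrightarrow> e r \<le> e s"
    using continuous_attains_sup[of "{0..T}" e] t by fastforce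
  have d_le: "d r \<le> e s * exp (2 * C * r)" if "r \<in> {0..T}" for r
    using max[OF that] by (simp add: e_def exp_minus field_simps)
  have "d s \<le> \<delta> + C * integral {0..s} d" using le[OF s] .
  also have "C * integral {0..s} d \<le> e s / 2 * exp (2 * C * s)"
  proof (rule exp_weight_integral_le[OF C])
    show "d integrable_on {0..s}"
      using cont s by (intro integrable_continuous_interval) (auto intro: continuous_on_subset)
    show "e s \<ge> 0" using nonneg[OF s] by (simp add: e_def)
  qed (use s d_le in auto)
  also have "d s = e s * exp (2 * C * s)" by (simp add: e_def exp_minus field_simps)
  finally have "e s / 2 * exp (2 * C * s) \<le> \<delta>" by simp
  moreover have "e s / 2 * 1 \<le> e s / 2 * exp (2 * C * s)"
    using nonneg[OF s] s C by (intro mult_left_mono) (auto simp: e_def)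
  ultimately have "e s \<le> 2 * \<delta>" by simp
  then show ?thesis using d_le[OF t] by (meson mult_right_mono exp_ge_zero order_trans)
qed

text \<open>
  The difference of the two right-hand sides splits into a Lipschitz part, which Gronwall's lemma
  absorbs, and a defect \<open>\<phi>\<close>. In applications \<open>\<phi>\<close> compares the two right-hand sides along the same
  state \<open>z\<close>.
\<close>

lemma mild_stability:
  fixes S :: "real \<Rightarrow> 'y::banach \<Rightarrow>\<^sub>L 'y"
  assumes M: "\<And>t. t \<in> {0..T} \<Longrightarrow> norm (S t) \<le> M" "M > 0" and K: "K > 0"
    and y: "continuous_on {0..T} y"
      "\<And>t. t \<in> {0..T} \<Longrightarrow> ((\<lambda>\<tau>. S (t - \<tau>) (a \<tau>)) has_integral (y t - S t y0)) {0..t}"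
    and z: "continuous_on {0..T} z"
      "\<And>t. t \<in> {0..T} \<Longrightarrow> ((\<lambda>\<tau>. S (t - \<tau>) (b \<tau>)) has_integral (z t - S t y0)) {0..t}"
    and ab: "\<And>\<tau>. \<tau> \<in> {0..T} \<Longrightarrow> norm (a \<tau> - b \<tau>) \<le> K * norm (y \<tau> - z \<tau>) + \<phi> \<tau>"
    and \<phi>: "\<phi> integrable_on {0..T}" "\<And>\<tau>. \<tau> \<in> {0..T} \<Longrightarrow> \<phi> \<tau> \<ge> 0" and t: "t \<in> {0..T}"
  shows "norm (y t - z t) \<le> 2 * (M * integral {0..T} \<phi>) * exp (2 * (M * K) * t)"
proof (rule gronwall[where d="\<lambda>t. norm (y t - z t)", OF _ _ _ _ t])
  show "continuous_on {0..T} (\<lambda>t. norm (y t - z t))" by (intro continuous_intros y z)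
  fix t assume t: "t \<in> {0..T}"
  have "continuous_on {0..t} (\<lambda>\<tau>. norm (y \<tau> - z \<tau>))"
    using t by (intro continuous_intros continuous_on_subset[OF y(1)] continuous_on_subset[OF z(1)]) auto
  then have i: "(\<lambda>\<tau>. norm (y \<tau> - z \<tau>)) integrable_on {0..t}" "\<phi> integrable_on {0..t}"
    using t by (auto intro: integrable_continuous_interval integrable_on_subinterval[OF \<phi>(1)])
  have "norm (y t - z t) = norm ((y t - S t y0) - (z t - S t y0))" by simp
  also have "\<dots> \<le> M * integral {0..t} (\<lambda>\<tau>. K * norm (y \<tau> - z \<tau>) + \<phi> \<tau>)"
    using M t ab i by (intro duhamel_integral_diff_le[OF M(1) _ t y(2)[OF t] z(2)[OF t]]
        integrable_add integrable_on_mult_right) auto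
  also have "\<dots> = M * K * integral {0..t} (\<lambda>\<tau>. norm (y \<tau> - z \<tau>)) + M * integral {0..t} \<phi>"
    using i by (subst Henstock_Kurzweil_Integration.integral_add)
      (auto intro: integrable_on_mult_right simp: algebra_simps)
  also have "integral {0..t} \<phi> \<le> integral {0..T} \<phi>"
    using t i \<phi> by (intro integral_subset_le) auto
  finally show "norm (y t - z t) \<le> M * integral {0..T} \<phi> + M * K * integral {0..t} (\<lambda>\<tau>. norm (y \<tau> - z \<tau>))"
    using M by simp
qed (use M K \<phi> in \<open>auto intro!: mult_nonneg_nonneg integral_nonneg\<close>)

text \<open>
  The substitution \<open>z t = exp (- c * t) * y t\<close> with \<open>c = 2 * M * K\<close> makes the solution operator a
  contraction with constant \<open>1/2\<close> for the supremum norm on all of \<open>{0..T}\<close>, so solutions on short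
  intervals need not be glued together. Bounded continuous functions on the whole line are obtained
  by evaluating at the nearest point of \<open>{0..T}\<close>.
\<close>

lemma mild_fixpoint_exists:
  fixes S :: "real \<Rightarrow> 'y::banach \<Rightarrow>\<^sub>L 'y" and g :: "real \<Rightarrow> 'y \<Rightarrow> 'y"
  assumes S: "C0_semigroup S" and T: "T > 0" and K: "K > 0"
    and meas: "\<And>y. continuous_on UNIV y \<Longrightarrow> strongly_measurable lebesgue (\<lambda>\<tau>. g \<tau> (y \<tau>))"
    and growth: "\<And>\<tau> x. norm (g \<tau> x) \<le> K * (1 + norm x)"
    and lip: "\<And>\<tau> x z. norm (g \<tau> x - g \<tau> z) \<le> K * norm (x - z)"
  obtains y where "continuous_on UNIV y"
    "\<And>t. t \<in> {0..T} \<Longrightarrow> ((\<lambda>\<tau>. S (t - \<tau>) (g \<tau> (y \<tau>))) has_integral (y t - S t y0)) {0..t}"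
proof -
  obtain M where M: "M \<ge> 1" "\<And>t. t \<in> {0..T} \<Longrightarrow> norm (S t) \<le> M"
    using C0_semigroup_bounded[OF S] by blast
  define c where "c = 2 * (M * K)"
  have C: "M * K > 0" and c: "c > 0" using M K by (auto simp: c_def)
  define G where "G z \<tau> = g \<tau> (exp (c * \<tau>) *\<^sub>R apply_bcontfun z \<tau>)" for z :: "real \<Rightarrow>\<^sub>C 'y" and \<tau>
  define Q where "Q z t = exp (- (c * t)) *\<^sub>R (S t y0 + duhamel S T (G z) t)" for z :: "real \<Rightarrow>\<^sub>C 'y" and t
  have Gm: "strongly_measurable lebesgue (G z)" for z
    unfolding G_def by (intro meas continuous_intros continuous_on_apply_bcontfun)
  have GB: "norm (G z \<tau>) \<le> K * (1 + exp (c * T) * norm z)" if "\<tau> \<in> {0..T}" for z \<tau>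
  proof -
    have "norm (exp (c * \<tau>) *\<^sub>R apply_bcontfun z \<tau>) \<le> exp (c * T) * norm z"
      using that c norm_bounded[of z \<tau>] by (auto intro!: mult_mono)
    then show ?thesis
      using growth[of \<tau> "exp (c * \<tau>) *\<^sub>R apply_bcontfun z \<tau>"] K unfolding G_def
      by (smt (verit) mult_left_mono)
  qed
  have Qcont: "continuous_on (cbox 0 T) (Q z)" for z
    unfolding Q_def cbox_interval
    by (intro continuous_intros C0_semigroup_orbit_continuous[OF S] duhamel_continuous[OF S Gm GB])
  have "\<exists>w :: real \<Rightarrow>\<^sub>C 'y. \<forall>t. w t = Q z (clamp 0 T t)" for z
    using continuous_on_cbox_bcontfunE[OF Qcont[of z]] by metis
  then obtain F :: "(real \<Rightarrow>\<^sub>C 'y) \<Rightarrow> (real \<Rightarrow>\<^sub>C 'y)" where F: "\<And>z t. F z t = Q z (clamp 0 T t)"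
    by metis
  have Qdist: "dist (Q z1 t) (Q z2 t) \<le> 1 / 2 * dist z1 z2" if t: "t \<in> {0..T}" for z1 z2 t
  proof -
    let ?D = "dist z1 z2"
    let ?\<phi> = "\<lambda>\<tau>. K * (exp (c * \<tau>) * ?D)"
    have i: "(\<lambda>\<tau>. exp (c * \<tau>) * ?D) integrable_on {0..t}"
      by (intro integrable_continuous_interval continuous_intros)
    have "norm (duhamel S T (G z1) t - duhamel S T (G z2) t) \<le> M * integral {0..t} ?\<phi>"
    proof (rule duhamel_integral_diff_le[OF M(2) _ t duhamel_has_integral[OF S Gm GB t] duhamel_has_integral[OF S Gm GB t]])
      fix \<tau>
      have "norm (G z1 \<tau> - G z2 \<tau>) \<le> K * norm (exp (c * \<tau>) *\<^sub>R (apply_bcontfun z1 \<tau> - apply_bcontfun z2 \<tau>))"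
        unfolding G_def using lip by (simp add: scaleR_diff_right)
      also have "\<dots> \<le> ?\<phi> \<tau>" using K dist_bounded[of z1 \<tau> z2] by (simp add: dist_norm)
      finally show "norm (G z1 \<tau> - G z2 \<tau>) \<le> ?\<phi> \<tau>" .
    qed (use M i in \<open>auto intro: integrable_on_mult_right\<close>)
    also have "\<dots> = M * K * integral {0..t} (\<lambda>\<tau>. exp (c * \<tau>) * ?D)" by simp
    also have "\<dots> \<le> ?D / 2 * exp (2 * (M * K) * t)"
      using t i C by (intro exp_weight_integral_le) (auto simp: c_def mult.commute)
    finally have "norm (duhamel S T (G z1) t - duhamel S T (G z2) t) \<le> ?D / 2 * exp (c * t)"
      by (simp add: c_def)
    then have "exp (- (c * t)) * norm (duhamel S T (G z1) t - duhamel S T (G z2) t)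
        \<le> exp (- (c * t)) * (?D / 2 * exp (c * t))"
      by (intro mult_left_mono) auto
    also have "\<dots> = 1 / 2 * ?D" by (simp add: exp_minus)
    finally show ?thesis by (simp add: Q_def dist_norm flip: scaleR_diff_right)
  qed
  have "dist (F z1) (F z2) \<le> 1 / 2 * dist z1 z2" for z1 z2
  proof (rule dist_bound)
    fix t
    have "clamp 0 T t \<in> {0..T}" using clamp_in_interval[of 0 T t] T by simp
    then show "dist (F z1 t) (F z2 t) \<le> 1 / 2 * dist z1 z2" unfolding F by (rule Qdist)
  qed
  then obtain z where z: "F z = z"
    using banach_fix_type[of "1/2" F] by auto
  define y where "y t = exp (c * t) *\<^sub>R apply_bcontfun z t" for t
  have Gy: "G z \<tau> = g \<tau> (y \<tau>)" for \<tau> by (simp add: G_def y_def)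
  show thesis
  proof (rule that)
    show "continuous_on UNIV y" unfolding y_def by (intro continuous_intros continuous_on_apply_bcontfun)
    fix t assume t: "t \<in> {0..T}"
    have "apply_bcontfun z t = Q z t" using F[of z t] z t by simp
    then have "y t - S t y0 = duhamel S T (G z) t"
      by (simp add: y_def Q_def flip: exp_add)
    then show "((\<lambda>\<tau>. S (t - \<tau>) (g \<tau> (y \<tau>))) has_integral (y t - S t y0)) {0..t}"
      using duhamel_has_integral[OF S Gm GB t, of z] by (simp add: Gy[symmetric])
  qed
qed

section \<open>Continuous dependence of the state on the control\<close>

text \<open>
  Simple functions that approximate a binary control need not be binary, whereas the assumptions
  on the right-hand side concern binary arguments only. Rounding repairs this: it is locally constant
  near binary vectors.
\<close>

definition round_binary :: "real^'m \<Rightarrow> real^'m" where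
  "round_binary w = (\<chi> i. if w $ i > 1 / 2 then 1 else 0)"

lemma round_binary_in_binary: "round_binary w \<in> binary"
  by (simp add: round_binary_def binary_def)

lemma round_binary_id: "w \<in> binary \<Longrightarrow> round_binary w = w"
  unfolding vec_eq_iff
proof
  fix i assume "w \<in> binary"
  then have "w $ i \<in> {0, 1}" by (auto simp: binary_def)
  then show "round_binary w $ i = w $ i" by (auto simp: round_binary_def)
qed

lemma round_binary_locally_constant:
  assumes w: "w \<in> binary"
  shows "\<forall>\<^sub>F z in nhds w. round_binary z = w"
  unfolding eventually_nhds_metric
proof (intro exI[of _ "1/2"] conjI allI impI)
  fix z :: "real^'a" assume z: "dist z w < 1 / 2"
  show "round_binary z = w"
    unfolding vec_eq_iff
  proof
    fix i
    have "\<bar>z $ i - w $ i\<bar> \<le> dist z w"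
      using component_le_norm_cart[of "z - w" i] by (simp add: dist_norm)
    moreover have "w $ i \<in> {0, 1}" using w by (auto simp: binary_def)
    ultimately show "round_binary z $ i = w $ i"
      using z by (auto simp: round_binary_def abs_le_iff)
  qed
qed simp

text \<open>
  The right-hand side is jointly continuous in all three arguments at binary \<open>v\<close> once it is composed
  with rounding, because \<open>v\<close> is then locally constant.
\<close>

lemma strongly_measurable_rhs:
  fixes f :: "'y::real_normed_vector \<Rightarrow> 'u::real_normed_vector \<Rightarrow> real^'m \<Rightarrow> 'y"
  assumes f: "admissible_rhs f"
    and y: "strongly_measurable M y" and u: "strongly_measurable M u"
    and v: "strongly_measurable M v" "\<And>t. v t \<in> binary"
  shows "strongly_measurable M (\<lambda>t. f (y t) (u t) (v t))"
proof -
  let ?h = "\<lambda>p. f (fst (fst p)) (snd (fst p)) (round_binary (snd p))"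
  have cont: "isCont ?h ((a, b), w)" if w: "w \<in> binary" for a b w
  proof -
    have "\<forall>\<^sub>F p in nhds ((a, b), w). round_binary (snd p) = w"
      by (rule eventually_compose_filterlim[OF round_binary_locally_constant[OF w]])
        (use tendsto_snd[OF filterlim_ident[of "nhds ((a, b), w)"]] in simp)
    then have "\<forall>\<^sub>F p in nhds ((a, b), w). ?h p = f (fst (fst p)) (snd (fst p)) w"
      by eventually_elim simp
    moreover have "isCont (\<lambda>p. f (fst (fst p)) (snd (fst p)) w) ((a, b), w)"
    proof -
      have "continuous_on UNIV (\<lambda>(y, u). f y u w)"
        using f w by (auto simp: admissible_rhs_def)
      then have g: "isCont (\<lambda>(y, u). f y u w) (fst ((a, b), w))"
        by (simp add: continuous_on_eq_continuous_at)
      have "isCont (\<lambda>p. (\<lambda>(y, u). f y u w) (fst p)) ((a, b), w)"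
        by (rule isCont_o2[where f=fst, OF _ g]) (intro continuous_intros)
      then show ?thesis by (simp add: split_def)
    qed
    ultimately show ?thesis by (rule isCont_cong[THEN iffD2])
  qed
  have "strongly_measurable M (\<lambda>t. ?h ((y t, u t), v t))"
    by (rule strongly_measurable_isCont[OF strongly_measurable_Pair[OF strongly_measurable_Pair[OF y u] v(1)]])
      (simp add: cont v(2))
  then show ?thesis by (simp add: round_binary_id v(2))
qed

lemma AE_leb_imp_closed_interval:
  assumes "AE t in leb T. P t"
  shows "AE t in lebesgue. t \<in> {0..T} \<longrightarrow> P t"
proof -
  have "AE t in lebesgue. t \<in> {0<..<T} \<longrightarrow> P t"
    using assms by (simp add: AE_restrict_space_iff)
  then show ?thesis
    using AE_lebesgue_neq[of 0] AE_lebesgue_neq[of T] by eventually_elim auto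
qed

text \<open>
  Mild solutions depend only on the classes of the controls modulo equality almost everywhere. This
  allows controls that are measurable and binary everywhere to be used in the proofs.
\<close>

lemma mild_solution_cong_AE:
  assumes "AE t in leb T. u t = u' t" and "AE t in leb T. v t = v' t"
  shows "mild_solution T S f y0 u v = mild_solution T S f y0 u' v'"
proof -
  have "AE t in leb T. u t = u' t \<and> v t = v' t" using assms by eventually_elim simp
  then have "AE t in lebesgue. t \<in> {0..T} \<longrightarrow> u t = u' t \<and> v t = v' t"
    by (rule AE_leb_imp_closed_interval)
  then obtain N where N: "negligible N" "\<And>t. t \<in> {0..T} - N \<Longrightarrow> u t = u' t \<and> v t = v' t"
    unfolding completion.AE_iff_null_sets negligible_iff_null_sets[symmetric] by auto
  have "((\<lambda>\<tau>. S (t - \<tau>) (f (y \<tau>) (u \<tau>) (v \<tau>))) has_integral I) {0..t} \<longleftrightarrow>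
      ((\<lambda>\<tau>. S (t - \<tau>) (f (y \<tau>) (u' \<tau>) (v' \<tau>))) has_integral I) {0..t}" if "t \<in> {0..T}" for t y I
    using that N(2) by (intro has_integral_spike_eq[OF N(1)]) auto
  then show ?thesis by (auto simp: mild_solution_def fun_eq_iff)
qed

lemma reduced_cost_cong_AE:
  assumes "AE t in leb T. u t = u' t" and "AE t in leb T. v t = v' t"
  shows "reduced_cost T S f y0 \<Phi> u v = reduced_cost T S f y0 \<Phi> u' v'"
  unfolding reduced_cost_def state_def mild_solution_cong_AE[OF assms] ..

lemma mild_solution_state:
  fixes S :: "real \<Rightarrow> 'y::banach \<Rightarrow>\<^sub>L 'y"
    and f :: "'y \<Rightarrow> 'u::real_normed_vector \<Rightarrow> real^'m \<Rightarrow> 'y"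
  assumes S: "C0_semigroup S" and T: "T > 0" and f: "admissible_rhs f"
    and u: "strongly_measurable lebesgue u"
    and v: "strongly_measurable lebesgue v" "\<And>t. v t \<in> binary"
  shows "mild_solution T S f y0 u v (state T S f y0 u v)"
proof -
  obtain K where K: "K > 0"
    and growth: "\<And>v y u. v \<in> binary \<Longrightarrow> norm (f y u v) \<le> K * (1 + norm y)"
    and lip: "\<And>v y z u. v \<in> binary \<Longrightarrow> norm (f y u v - f z u v) \<le> K * norm (y - z)"
    using f unfolding admissible_rhs_def by blast
  obtain y where "continuous_on UNIV y"
    "\<And>t. t \<in> {0..T} \<Longrightarrow> ((\<lambda>\<tau>. S (t - \<tau>) (f (y \<tau>) (u \<tau>) (v \<tau>))) has_integral (y t - S t y0)) {0..t}"
  proof (rule mild_fixpoint_exists[OF S T K, of "\<lambda>\<tau> y. f y (u \<tau>) (v \<tau>)"])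
    show "strongly_measurable lebesgue (\<lambda>\<tau>. f (y \<tau>) (u \<tau>) (v \<tau>))" if "continuous_on UNIV y" for y
      by (rule strongly_measurable_rhs[OF f strongly_measurable_continuous[OF that] u v])
  qed (use growth lip v(2) in auto)
  then have "mild_solution T S f y0 u v y"
    by (auto simp: mild_solution_def intro: continuous_on_subset)
  then show ?thesis unfolding state_def by (rule someI[of "mild_solution T S f y0 u v"])
qed

text \<open>
  Stability is applied with the defect taken along the limit state. That function of time is fixed,
  so the defect tends to zero almost everywhere by continuity of \<open>f\<close> in \<open>u\<close>, and it is bounded by the
  linear growth of \<open>f\<close>.
\<close>

lemma state_tendsto:
  fixes S :: "real \<Rightarrow> 'y::banach \<Rightarrow>\<^sub>L 'y"
    and f :: "'y \<Rightarrow> 'u::real_normed_vector \<Rightarrow> real^'m \<Rightarrow> 'y"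
  assumes S: "C0_semigroup S" and T: "T > 0" and f: "admissible_rhs f"
    and un: "\<And>n. strongly_measurable lebesgue (un n)" and u: "strongly_measurable lebesgue u"
    and v: "strongly_measurable lebesgue v" "\<And>t. v t \<in> binary"
    and lim: "AE t in leb T. (\<lambda>n. un n t) \<longlonglongrightarrow> u t"
  shows "(\<lambda>n. state T S f y0 (un n) v T) \<longlonglongrightarrow> state T S f y0 u v T"
proof -
  obtain K where K: "K > 0"
    and fcont: "\<And>v. v \<in> binary \<Longrightarrow> continuous_on UNIV (\<lambda>(y, u). f y u v)"
    and growth: "\<And>v y u. v \<in> binary \<Longrightarrow> norm (f y u v) \<le> K * (1 + norm y)"
    and lip: "\<And>v y z u. v \<in> binary \<Longrightarrow> norm (f y u v - f z u v) \<le> K * norm (y - z)"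
    using f unfolding admissible_rhs_def by blast
  obtain M where M: "M \<ge> 1" "\<And>t. t \<in> {0..T} \<Longrightarrow> norm (S t) \<le> M"
    using C0_semigroup_bounded[OF S] by blast
  define y where "y = state T S f y0 u v"
  define yn where "yn n = state T S f y0 (un n) v" for n
  have y: "continuous_on {0..T} y"
      "\<And>t. t \<in> {0..T} \<Longrightarrow> ((\<lambda>\<tau>. S (t - \<tau>) (f (y \<tau>) (u \<tau>) (v \<tau>))) has_integral (y t - S t y0)) {0..t}"
    and yn: "\<And>n. continuous_on {0..T} (yn n)"
      "\<And>n t. t \<in> {0..T} \<Longrightarrow> ((\<lambda>\<tau>. S (t - \<tau>) (f (yn n \<tau>) (un n \<tau>) (v \<tau>))) has_integral (yn n t - S t y0)) {0..t}"
    using mild_solution_state[OF S T f u v, of y0] mild_solution_state[OF S T f un v, of y0]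
    unfolding y_def yn_def mild_solution_def by auto
  \<comment> \<open>\<open>y\<close> is unspecified outside \<open>{0..T}\<close>; \<open>yc\<close> extends it continuously, hence measurably\<close>
  define yc where "yc t = y (clamp 0 T t)" for t
  have yc: "continuous_on UNIV yc" "\<And>t. t \<in> {0..T} \<Longrightarrow> yc t = y t"
    unfolding yc_def using y(1) by (auto intro: clamp_continuous_on)
  obtain R where R: "\<And>t. t \<in> {0..T} \<Longrightarrow> norm (y t) \<le> R"
    using compact_imp_bounded[OF compact_continuous_image[OF y(1)]] unfolding bounded_iff by force
  define h where "h n t = f (yc t) (un n t) (v t)" for n t
  define h0 where "h0 t = f (yc t) (u t) (v t)" for t
  have hm: "strongly_measurable lebesgue (h n)" "strongly_measurable lebesgue h0" for n
    unfolding h_def h0_def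
    by (intro strongly_measurable_rhs[OF f] strongly_measurable_continuous yc un u v)+
  have KR: "K * (1 + norm (yc t)) \<le> K * (1 + R)" if "t \<in> {0..T}" for t
    using R[OF that] yc(2)[OF that] K by simp
  have hB: "norm (h n t) \<le> K * (1 + R)" "norm (h0 t) \<le> K * (1 + R)" if "t \<in> {0..T}" for n t
    unfolding h_def h0_def using order_trans[OF growth[OF v(2)] KR[OF that]] by auto
  have "AE t in lebesgue. t \<in> {0..T} \<longrightarrow> (\<lambda>n. h n t) \<longlonglongrightarrow> h0 t"
    using AE_leb_imp_closed_interval[OF lim]
  proof eventually_elim
    case (elim t)
    show ?case
    proof
      assume "t \<in> {0..T}"
      then have "(\<lambda>n. (yc t, un n t)) \<longlonglongrightarrow> (yc t, u t)" using elim by (intro tendsto_intros) auto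
      from continuous_on_tendsto_compose[OF fcont[OF v(2)[of t]] this]
      show "(\<lambda>n. h n t) \<longlonglongrightarrow> h0 t" by (simp add: h_def h0_def)
    qed
  qed
  then have lim0: "(\<lambda>n. integral {0..T} (\<lambda>t. norm (h n t - h0 t))) \<longlonglongrightarrow> 0"
    by (intro strongly_measurable_bounded_convergence(1)[OF hm hB])
  have i: "(\<lambda>t. norm (h n t - h0 t)) integrable_on {0..T}" for n
    by (intro strongly_measurable_norm_integrable_on[where B="K * (1 + R) + K * (1 + R)"] strongly_measurable_diff hm)
      (rule order_trans[OF norm_triangle_ineq4 add_mono[OF hB]])
  have "norm (yn n T - y T) \<le> 2 * (M * integral {0..T} (\<lambda>t. norm (h n t - h0 t))) * exp (2 * (M * K) * T)" for n
  proof (rule mild_stability[OF M(2) _ K yn(1) yn(2) y(1) y(2)])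
    fix t assume t: "t \<in> {0..T}"
    have "norm (f (yn n t) (un n t) (v t) - f (y t) (u t) (v t))
      \<le> norm (f (yn n t) (un n t) (v t) - f (y t) (un n t) (v t)) + norm (f (y t) (un n t) (v t) - f (y t) (u t) (v t))"
      using norm_triangle_ineq[of "f (yn n t) (un n t) (v t) - f (y t) (un n t) (v t)"
          "f (y t) (un n t) (v t) - f (y t) (u t) (v t)"] by simp
    also have "\<dots> \<le> K * norm (yn n t - y t) + norm (h n t - h0 t)"
      using lip[OF v(2)] yc(2)[OF t] by (simp add: h_def h0_def)
    finally show "norm (f (yn n t) (un n t) (v t) - f (y t) (u t) (v t)) \<le> K * norm (yn n t - y t) + norm (h n t - h0 t)" .
  qed (use M T i in auto)
  moreover have "(\<lambda>n. 2 * (M * integral {0..T} (\<lambda>t. norm (h n t - h0 t))) * exp (2 * (M * K) * T)) \<longlonglongrightarrow> 0"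
    by (intro tendsto_mult_left_zero tendsto_mult_right_zero lim0)
  ultimately have "(\<lambda>n. yn n T - y T) \<longlonglongrightarrow> 0"
    by (rule Lim_null_comparison[OF always_eventually[OF allI]])
  then show ?thesis unfolding y_def yn_def by (rule LIM_zero_cancel)
qed

section \<open>Convergence in \<open>L\<^sup>p\<close> and convergence almost everywhere\<close>

lemma Lp_strongly_measurable: "g \<in> Lp T p \<Longrightarrow> strongly_measurable (leb T) g"
  by (simp add: Lp_def)

lemma strongly_measurable_norm_on:
  fixes g :: "real \<Rightarrow> 'b::real_normed_vector"
  assumes "strongly_measurable (lebesgue_on S) g" and "S \<in> sets lebesgue"
  shows "(\<lambda>t. norm (g t)) \<in> borel_measurable (lebesgue_on S)"
  using measurable_restrict_space1[OF strongly_measurable_norm[OF strongly_measurable_extend[OF assms]], of S]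
  by (subst measurable_cong[where g="\<lambda>t. norm (if t \<in> S then g t else 0)"]) auto

text \<open>
  \<open>Lp_norm\<close> is a real number, so an infinite essential supremum would be read as \<open>0\<close>. Membership
  in \<open>L\<^sup>\<infinity>\<close> rules this out.
\<close>

lemma Linf_AE_norm_diff_le:
  fixes g h :: "real \<Rightarrow> 'b::real_normed_vector"
  assumes g: "g \<in> Lp T \<infinity>" and h: "h \<in> Lp T \<infinity>"
  shows "AE t in leb T. norm (g t - h t) \<le> Lp_norm T \<infinity> (\<lambda>t. g t - h t)"
proof -
  let ?e = "\<lambda>g. esssup (leb T) (\<lambda>t. ennreal (norm (g t)))"
  have m: "(\<lambda>t. ennreal (norm (g t - h t))) \<in> borel_measurable (leb T)"
    by (intro measurable_compose[OF _ measurable_ennreal] strongly_measurable_norm_on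
        strongly_measurable_diff Lp_strongly_measurable[OF g] Lp_strongly_measurable[OF h]) simp
  have "AE t in leb T. ennreal (norm (g t - h t)) \<le> ?e g + ?e h"
    using esssup_AE[of "\<lambda>t. ennreal (norm (g t))" "leb T"] esssup_AE[of "\<lambda>t. ennreal (norm (h t))" "leb T"]
  proof eventually_elim
    case (elim t)
    have "ennreal (norm (g t - h t)) \<le> ennreal (norm (g t)) + ennreal (norm (h t))"
      by (metis ennreal_leI ennreal_plus norm_ge_zero norm_triangle_ineq4)
    also have "\<dots> \<le> ?e g + ?e h" using elim by (rule add_mono)
    finally show ?case .
  qed
  then have "?e (\<lambda>t. g t - h t) \<le> ?e g + ?e h" by (rule esssup_I[OF m])
  also have "\<dots> < \<infinity>" using g h by (simp add: Lp_def)
  finally have fin: "?e (\<lambda>t. g t - h t) < \<infinity>" .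
  show ?thesis
    using esssup_AE[of "\<lambda>t. ennreal (norm (g t - h t))" "leb T"]
  proof eventually_elim
    case (elim t)
    then show ?case
      using enn2real_mono[OF elim] fin by (simp add: Lp_norm_def)
  qed
qed

lemma powr_add_le:
  fixes a b q :: real
  assumes "a \<ge> 0" "b \<ge> 0" "q > 0"
  shows "(a + b) powr q \<le> 2 powr q * (a powr q + b powr q)"
proof -
  have "(a + b) powr q \<le> (2 * max a b) powr q"
    using assms by (intro powr_mono2) auto
  also have "\<dots> = 2 powr q * max a b powr q" using assms by (simp add: powr_mult)
  also have "\<dots> \<le> 2 powr q * (a powr q + b powr q)"
    by (intro mult_left_mono) (auto simp: max_def)
  finally show ?thesis .
qed

text \<open>
  For finite exponent \<open>q\<close> the \<open>q\<close>-th powers of the distances tend to zero in \<open>L\<^sup>1\<close>, which also works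
  for \<open>q < 1\<close>. Integrability of these powers has to be checked because the integral of a
  nonintegrable function is \<open>0\<close>.
\<close>

lemma Lp_tendsto_AE_subseq:
  fixes u :: "nat \<Rightarrow> real \<Rightarrow> 'b::real_normed_vector"
  assumes p: "p > 0" and un: "\<And>n. u n \<in> Lp T p" and us: "us \<in> Lp T p"
    and lim: "Lp_tendsto T p u us"
  obtains r :: "nat \<Rightarrow> nat" where "strict_mono r" "AE t in leb T. (\<lambda>n. u (r n) t) \<longlonglongrightarrow> us t"
proof (cases "p = \<infinity>")
  case True
  have L: "(\<lambda>n. Lp_norm T \<infinity> (\<lambda>t. u n t - us t)) \<longlonglongrightarrow> 0"
    using lim True by (simp add: Lp_tendsto_def)
  have "AE t in leb T. \<forall>n. norm (u n t - us t) \<le> Lp_norm T \<infinity> (\<lambda>t. u n t - us t)"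
    unfolding AE_all_countable using Linf_AE_norm_diff_le un us True by blast
  then have "AE t in leb T. (\<lambda>n. u (id n) t) \<longlonglongrightarrow> us t"
  proof eventually_elim
    case (elim t)
    have "(\<lambda>n. u n t - us t) \<longlonglongrightarrow> 0"
      by (rule Lim_null_comparison[OF _ L]) (use elim in simp)
    then show ?case by (simp add: LIM_zero_cancel)
  qed
  then show thesis using that strict_mono_id by blast
next
  case False
  define q where "q = enn2real p"
  have q: "q > 0" using p False by (simp add: q_def enn2real_positive_iff less_top)
  define \<phi> where "\<phi> n t = norm (u n t - us t) powr q" for n t
  have [measurable]: "(\<lambda>t. norm (u n t - us t)) \<in> borel_measurable (leb T)" for n
    by (intro strongly_measurable_norm_on strongly_measurable_diff
        Lp_strongly_measurable[OF un] Lp_strongly_measurable[OF us]) auto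
  have [measurable]: "\<phi> n \<in> borel_measurable (leb T)" for n
    unfolding \<phi>_def by measurable
  have int: "integrable (leb T) (\<phi> n)" for n
  proof (rule Bochner_Integration.integrable_bound)
    show "integrable (leb T) (\<lambda>t. 2 powr q * (norm (u n t) powr q + norm (us t) powr q))"
      using un[of n] us False by (auto simp: Lp_def q_def)
    have "norm (\<phi> n t) \<le> norm (2 powr q * (norm (u n t) powr q + norm (us t) powr q))" for t
    proof -
      have "\<phi> n t \<le> (norm (u n t) + norm (us t)) powr q"
        unfolding \<phi>_def using q by (intro powr_mono2 norm_triangle_ineq4) auto
      also have "\<dots> \<le> 2 powr q * (norm (u n t) powr q + norm (us t) powr q)"
        using q by (intro powr_add_le) auto
      finally show ?thesis by (simp add: \<phi>_def)
    qed
    then show "AE t in leb T. norm (\<phi> n t) \<le> norm (2 powr q * (norm (u n t) powr q + norm (us t) powr q))"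
      by simp
  qed simp
  have nn: "(LINT t|leb T. \<phi> n t) \<ge> 0" for n by (simp add: \<phi>_def)
  have "(\<lambda>n. (LINT t|leb T. \<phi> n t) powr (1 / q)) \<longlonglongrightarrow> 0"
    using lim False by (simp add: Lp_tendsto_def Lp_norm_def q_def \<phi>_def)
  then have "(\<lambda>n. ((LINT t|leb T. \<phi> n t) powr (1 / q)) powr q) \<longlonglongrightarrow> 0"
    by (rule tendsto_zero_powrI[OF _ tendsto_const _ q]) simp
  then have "(\<lambda>n. LINT t|leb T. norm (\<phi> n t)) \<longlonglongrightarrow> 0"
    using q nn by (simp add: powr_powr \<phi>_def)
  from tendsto_L1_AE_subseq[OF int this]
  obtain r :: "nat \<Rightarrow> nat" where r: "strict_mono r" "AE t in leb T. (\<lambda>n. \<phi> (r n) t) \<longlonglongrightarrow> 0"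
    by blast
  from r(2) have "AE t in leb T. (\<lambda>n. u (r n) t) \<longlonglongrightarrow> us t"
  proof eventually_elim
    case (elim t)
    have "(\<lambda>n. \<phi> (r n) t powr (1 / q)) \<longlonglongrightarrow> 0"
      using elim by (rule tendsto_zero_powrI[OF _ tendsto_const]) (use q in \<open>auto simp: \<phi>_def\<close>)
    then have "(\<lambda>n. norm (u (r n) t - us t)) \<longlonglongrightarrow> 0"
      using q by (simp add: \<phi>_def powr_powr)
    then show ?case by (simp add: tendsto_norm_zero_iff LIM_zero_iff)
  qed
  then show thesis using that r(1) by blast
qed

lemma binary_eqI:
  assumes "a \<in> binary" "b \<in> binary" "norm (a - b) < 1"
  shows "a = b"
  unfolding vec_eq_iff
proof
  fix i
  have "\<bar>a $ i - b $ i\<bar> < 1"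
    using component_le_norm_cart[of "a - b" i] assms(3) by simp
  then show "a $ i = b $ i" using assms(1,2) by (auto simp: binary_def dest!: spec[of _ i])
qed

text \<open>
  Distinct binary vectors have distance at least \<open>1\<close>, so \<open>L\<^sup>\<infinity>\<close> is discrete on binary controls.
\<close>

lemma Vt_Linf_tendsto_eventually_AE_eq:
  assumes v: "\<And>n. v n \<in> Vt T" and vs: "vs \<in> Vt T" and lim: "Lp_tendsto T \<infinity> v vs"
  shows "\<forall>\<^sub>F n in sequentially. AE t in leb T. v n t = vs t"
proof -
  have "\<forall>\<^sub>F n in sequentially. Lp_norm T \<infinity> (\<lambda>t. v n t - vs t) < 1"
    using lim unfolding Lp_tendsto_def by (rule order_tendstoD) simp
  then show ?thesis
  proof eventually_elim
    case (elim n)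
    have "AE t in leb T. norm (v n t - vs t) \<le> Lp_norm T \<infinity> (\<lambda>t. v n t - vs t)"
      using v[of n] vs by (intro Linf_AE_norm_diff_le) (auto simp: Vt_def)
    moreover have "AE t in leb T. v n t \<in> binary" "AE t in leb T. vs t \<in> binary"
      using v[of n] vs by (auto simp: Vt_def)
    ultimately show ?case
      by eventually_elim (use elim in \<open>auto intro: binary_eqI\<close>)
  qed
qed

lemma Lp_measurable_representative:
  fixes u :: "real \<Rightarrow> 'b::real_normed_vector"
  assumes "u \<in> Lp T p"
  obtains u' where "strongly_measurable lebesgue u'" "AE t in leb T. u t = u' t"
proof (rule that)
  show "strongly_measurable lebesgue (\<lambda>t. if t \<in> {0<..<T} then u t else 0)"
    by (rule strongly_measurable_extend[OF Lp_strongly_measurable[OF assms]]) simp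
  show "AE t in leb T. u t = (if t \<in> {0<..<T} then u t else 0)"
    by (rule AE_I2) (simp add: space_restrict_space)
qed

lemma Vt_binary_representative:
  assumes v: "v \<in> Vt T"
  obtains v' where "strongly_measurable lebesgue v'" "\<And>t. v' t \<in> binary" "AE t in leb T. v t = v' t"
proof -
  let ?v = "\<lambda>t. if t \<in> {0<..<T} then v t else 0"
  have b: "AE t in leb T. v t \<in> binary" using v by (simp add: Vt_def)
  show thesis
  proof (rule that[of "\<lambda>t. round_binary (?v t)"])
    have "AE t in lebesgue. t \<in> {0<..<T} \<longrightarrow> v t \<in> binary"
      using b by (simp add: AE_restrict_space_iff)
    then have "AE t in lebesgue. isCont round_binary (?v t)"
    proof eventually_elim
      case (elim t)
      then have *: "?v t \<in> binary" by (auto simp: binary_def)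
      show ?case
        using isCont_cong[OF round_binary_locally_constant[OF *]] by simp
    qed
    moreover have "strongly_measurable lebesgue ?v"
      using v by (intro strongly_measurable_extend) (auto simp: Vt_def Lp_def)
    ultimately show "strongly_measurable lebesgue (\<lambda>t. round_binary (?v t))"
      by (rule strongly_measurable_isCont[where h=round_binary, rotated])
    show "AE t in leb T. v t = round_binary (?v t)"
      using b AE_space by eventually_elim (simp add: space_restrict_space round_binary_id)
  qed (rule round_binary_in_binary)
qed

section \<open>Iterates of the penalty method\<close>

lemma adm_inner_feasible:
  assumes "adm_inner \<epsilon> J F G z r" and "z \<in> F \<times> G"
  shows "r \<in> F \<times> G"
  using assms by (induction rule: adm_inner.induct) (auto simp: eps_optimal_def)

text \<open>
  If the loop stops after the update of the first block, that block is approximately optimal up to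
  \<open>\<epsilon>/2\<close> by construction. If it stops before, the rejected candidate is optimal up to \<open>\<epsilon>/2\<close> and
  improves on the current point by at most \<open>\<epsilon>/2\<close>.
\<close>

lemma adm_inner_fst_optimal:
  assumes "adm_inner \<epsilon> J F G z r" and "\<epsilon> \<ge> 0" and "x \<in> F"
  shows "J (fst r) (snd r) \<le> J x (snd r) + \<epsilon>"
  using assms
proof (induction rule: adm_inner.induct)
  case (stop_fst w x' x0)
  then have "J x' w \<le> J x w + \<epsilon> / 2" by (auto simp: eps_optimal_def)
  then show ?case using stop_fst by simp
next
  case (stop_snd w x' x0 w')
  then have "J x' w \<le> J x w + \<epsilon> / 2" by (auto simp: eps_optimal_def)
  then show ?case using stop_snd by simp
qed simp

lemma penalty_adm_feasible:
  assumes "penalty_adm T \<Psi> \<Sigma> \<Gamma> \<epsilon> \<rho> X"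
  shows "X k \<in> (\<Sigma> \<times> Vt T) \<times> \<Gamma>"
proof (induction k)
  case (Suc k)
  have "adm_inner \<epsilon> (penalty_cost T \<Psi> (\<rho> (Suc k))) (\<Sigma> \<times> Vt T) \<Gamma> (X k) (X (Suc k))"
    using assms by (auto simp: penalty_adm_def dest: spec[of _ "Suc k"])
  then show ?case using Suc by (rule adm_inner_feasible)
qed (use assms in \<open>simp add: penalty_adm_def\<close>)

lemma penalty_cost_eq:
  assumes "AE t in leb T. v t = w t"
  shows "penalty_cost T \<Psi> \<rho> (u, v) w = \<Psi> u v"
proof -
  have "AE t in leb T. l1_norm (v t - w t) = 0"
    using assms by eventually_elim (simp add: l1_norm_def)
  then have "(LINT t|leb T. l1_norm (v t - w t)) = 0" by (rule integral_eq_zero_AE)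
  then show ?thesis by (simp add: penalty_cost_def)
qed

lemma lipschitz_on_bounded_isCont:
  assumes "lipschitz_on_bounded \<Phi>"
  shows "isCont \<Phi> x"
proof -
  obtain L where "L-lipschitz_on (ball x 1) \<Phi>"
    using assms bounded_ball unfolding lipschitz_on_bounded_def by blast
  then have "continuous_on (ball x 1) \<Phi>" by (rule lipschitz_on_continuous_on)
  then show ?thesis by (simp add: continuous_on_eq_continuous_at)
qed

text \<open>
  The controls are replaced by representatives on which \<open>state_tendsto\<close> applies, and \<open>v (r n)\<close> is
  replaced by the limit \<open>vs\<close>, with which it eventually agrees almost everywhere.
\<close>

lemma reduced_cost_tendsto_subseq:
  fixes S :: "real \<Rightarrow> 'y::banach \<Rightarrow>\<^sub>L 'y"
    and f :: "'y \<Rightarrow> 'u::banach \<Rightarrow> real^'m \<Rightarrow> 'y"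
  assumes S: "C0_semigroup S" and T: "T > 0" and p: "p > 0" and f: "admissible_rhs f"
    and \<Phi>: "lipschitz_on_bounded \<Phi>"
    and u: "\<And>k. u k \<in> Lp T p" and us: "us \<in> Lp T p" and ulim: "Lp_tendsto T p u us"
    and v: "\<And>k. v k \<in> Vt T" and vs: "vs \<in> Vt T" and vlim: "Lp_tendsto T \<infinity> v vs"
  obtains r :: "nat \<Rightarrow> nat" where "strict_mono r"
    "(\<lambda>n. reduced_cost T S f y0 \<Phi> (u (r n)) (v (r n))) \<longlonglongrightarrow> reduced_cost T S f y0 \<Phi> us vs"
proof -
  obtain r :: "nat \<Rightarrow> nat" where r: "strict_mono r" "AE t in leb T. (\<lambda>n. u (r n) t) \<longlonglongrightarrow> us t"
    using Lp_tendsto_AE_subseq[OF p u us ulim] by blast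
  have "\<exists>u'. strongly_measurable lebesgue u' \<and> (AE t in leb T. u k t = u' t)" for k
    using Lp_measurable_representative[OF u[of k]] by metis
  then obtain u' where u': "\<And>k. strongly_measurable lebesgue (u' k)" "\<And>k. AE t in leb T. u k t = u' k t"
    by metis
  obtain us' where us': "strongly_measurable lebesgue us'" "AE t in leb T. us t = us' t"
    using Lp_measurable_representative[OF us] by metis
  obtain vs' where vs': "strongly_measurable lebesgue vs'" "\<And>t. vs' t \<in> binary" "AE t in leb T. vs t = vs' t"
    using Vt_binary_representative[OF vs] by metis
  have "AE t in leb T. \<forall>k. u k t = u' k t" using u'(2) by (simp add: AE_all_countable)
  then have "AE t in leb T. (\<lambda>n. u' (r n) t) \<longlonglongrightarrow> us' t"
    using us'(2) r(2) by eventually_elim simp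
  from state_tendsto[OF S T f u'(1) us'(1) vs'(1,2) this]
  have "(\<lambda>n. reduced_cost T S f y0 \<Phi> (u' (r n)) vs') \<longlonglongrightarrow> reduced_cost T S f y0 \<Phi> us' vs'"
    unfolding reduced_cost_def by (rule isCont_tendsto_compose[OF lipschitz_on_bounded_isCont[OF \<Phi>]])
  also have "reduced_cost T S f y0 \<Phi> us' vs' = reduced_cost T S f y0 \<Phi> us vs"
    using us'(2) vs'(3) by (intro reduced_cost_cong_AE) (auto elim: eventually_mono)
  finally have L: "(\<lambda>n. reduced_cost T S f y0 \<Phi> (u' (r n)) vs') \<longlonglongrightarrow> reduced_cost T S f y0 \<Phi> us vs" .
  have "\<forall>\<^sub>F n in sequentially. AE t in leb T. v (r n) t = vs t"
    using Vt_Linf_tendsto_eventually_AE_eq[OF v vs vlim] eventually_subseq[OF r(1)] by blast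
  then have "\<forall>\<^sub>F n in sequentially. reduced_cost T S f y0 \<Phi> (u' (r n)) vs' = reduced_cost T S f y0 \<Phi> (u (r n)) (v (r n))"
  proof eventually_elim
    case (elim n)
    have "AE t in leb T. vs' t = v (r n) t" using elim vs'(3) by eventually_elim simp
    then show ?case
      using u'(2)[of "r n"] by (intro reduced_cost_cong_AE) (auto elim: eventually_mono)
  qed
  with L have "(\<lambda>n. reduced_cost T S f y0 \<Phi> (u (r n)) (v (r n))) \<longlonglongrightarrow> reduced_cost T S f y0 \<Phi> us vs"
    by (rule Lim_transform_eventually)
  then show thesis using that r(1) by blast
qed

theorem corollary1:
  fixes T \<epsilon> :: real
    and p :: ennreal
    and D :: "'y::banach set" and A :: "'y \<Rightarrow> 'y"
    and S :: "real \<Rightarrow> 'y \<Rightarrow>\<^sub>L 'y"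
    and f :: "'y \<Rightarrow> 'u::banach \<Rightarrow> real^'m \<Rightarrow> 'y"
    and y0 :: 'y and \<Phi> :: "'y \<Rightarrow> real"
    and \<Sigma> :: "(real \<Rightarrow> 'u) set" and \<Gamma> :: "(real \<Rightarrow> real^'m) set"
    and \<rho> :: "nat \<Rightarrow> real"
    and u :: "nat \<Rightarrow> real \<Rightarrow> 'u" and v w :: "nat \<Rightarrow> real \<Rightarrow> real^'m"
    and us :: "real \<Rightarrow> 'u" and vs ws :: "real \<Rightarrow> real^'m"
  assumes "T > 0" and "p > 0" and "\<epsilon> \<ge> 0"
    and "densely_defined_linear D A" and "generates D A S"
    and "admissible_rhs f" and "lipschitz_on_bounded \<Phi>"
    and "\<Sigma> \<subseteq> Lp T p" and "ae_closed T \<Sigma>"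
    and "\<Gamma> \<subseteq> Vt T" and "ae_closed T \<Gamma>"
    and "penalty_adm T (reduced_cost T S f y0 \<Phi>) \<Sigma> \<Gamma> \<epsilon> \<rho> (\<lambda>k. ((u k, v k), w k))"
    and "filterlim \<rho> at_top sequentially"
    and "Lp_tendsto T p u us" and "Lp_tendsto T \<infinity> v vs" and "Lp_tendsto T \<infinity> w ws"
    and "((us, vs), ws) \<in> split_feasible T \<Sigma> \<Gamma>"
  shows "p_eps_minimal T (reduced_cost T S f y0 \<Phi>) \<Sigma> \<Gamma> \<epsilon> us vs \<and>
         (\<epsilon> = 0 \<longrightarrow> p_minimal T (reduced_cost T S f y0 \<Phi>) \<Sigma> \<Gamma> us vs)"
proof -
  let ?\<Psi> = "reduced_cost T S f y0 \<Phi>"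
  have S: "C0_semigroup S" using assms(5) by (simp add: generates_def)
  have us: "us \<in> \<Sigma>" and vs: "vs \<in> Vt T" and ws: "ws \<in> \<Gamma>" and eq: "AE t in leb T. vs t = ws t"
    using assms(17) by (auto simp: split_feasible_def)
  \<comment> \<open>\<open>vs\<close> is merely almost everywhere equal to the feasible \<open>ws\<close>\<close>
  have vs_\<Gamma>: "vs \<in> \<Gamma>" using assms(11) ws eq by (auto simp: ae_closed_def)
  have feas: "u k \<in> \<Sigma>" "v k \<in> Vt T" "w k \<in> \<Gamma>" for k
    using penalty_adm_feasible[OF assms(12), of k] by auto
  have v_eq: "\<forall>\<^sub>F k in sequentially. AE t in leb T. v k t = vs t"
    by (rule Vt_Linf_tendsto_eventually_AE_eq[OF feas(2) vs assms(15)])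
  have w_eq: "\<forall>\<^sub>F k in sequentially. AE t in leb T. w k t = ws t"
    using assms(10) feas(3) ws by (intro Vt_Linf_tendsto_eventually_AE_eq[OF _ _ assms(16)]) auto
  obtain r :: "nat \<Rightarrow> nat" where r: "strict_mono r"
    "(\<lambda>n. ?\<Psi> (u (r n)) (v (r n))) \<longlonglongrightarrow> ?\<Psi> us vs"
    using reduced_cost_tendsto_subseq[OF S assms(1,2,6,7) _ _ assms(14) feas(2) vs assms(15), of y0]
      assms(8) feas(1) us by blast
  have key: "?\<Psi> us vs \<le> ?\<Psi> u' v' + \<epsilon>"
    if u': "u' \<in> \<Sigma>" and v': "v' \<in> Vt T" "AE t in leb T. v' t = vs t" for u' v'
  proof -
    have "\<forall>\<^sub>F k in sequentially. ?\<Psi> (u k) (v k) \<le> ?\<Psi> u' v' + \<epsilon>"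
      using v_eq w_eq eventually_ge_at_top[of 1]
    proof eventually_elim
      case (elim k)
      \<comment> \<open>the competitor \<open>(u', v')\<close> is tested in the penalty problem, where \<open>v' \<noteq> w k\<close> is allowed\<close>
      have "adm_inner \<epsilon> (penalty_cost T ?\<Psi> (\<rho> k)) (\<Sigma> \<times> Vt T) \<Gamma> ((u (k - 1), v (k - 1)), w (k - 1)) ((u k, v k), w k)"
        using assms(12) elim(3) by (auto simp: penalty_adm_def)
      from adm_inner_fst_optimal[OF this assms(3), of "(u', v')"]
      have "penalty_cost T ?\<Psi> (\<rho> k) (u k, v k) (w k) \<le> penalty_cost T ?\<Psi> (\<rho> k) (u', v') (w k) + \<epsilon>"
        using u' v' by simp
      moreover have "AE t in leb T. v k t = w k t"
        using elim(1,2) eq by eventually_elim simp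
      moreover have "AE t in leb T. v' t = w k t"
        using v'(2) elim(2) eq by eventually_elim simp
      ultimately show ?case by (simp add: penalty_cost_eq)
    qed
    then have "\<forall>\<^sub>F n in sequentially. ?\<Psi> (u (r n)) (v (r n)) \<le> ?\<Psi> u' v' + \<epsilon>"
      using eventually_subseq[OF r(1)] by blast
    with r(2) show ?thesis by (intro tendsto_upperbound) auto
  qed
  have "p_eps_minimal T ?\<Psi> \<Sigma> \<Gamma> \<epsilon> us vs"
    using us vs vs_\<Gamma> key assms(3) by (auto simp: p_eps_minimal_def p_eps_optimal_def split_feasible_def)
  then show ?thesis by (auto simp: p_minimal_def)
qed

end
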